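(* Suppose $F$ is a distribution on $\mathbb{R}$ satisfying $\int_0^\infty(1-F(x))^{1/d}\,dx<\infty$ and such that $N=0$. Then, for any $c>d/(d-1)$, almost surely $$\lim_{n\to\infty}(\log n)^{-c}\,n^{-1}G_n=0.$$
   Context: Fix $d\ge2$. $\{X_{\mathbf{v}}:\mathbf{v}\in\mathbb{Z}^d\}$ are independent real random variables with common distribution (function) $F$. A lattice animal is a finite non-empty connected (nearest-neighbour) set of sites $\xi\subset\mathbb{Z}^d$, with weight $S(\xi)=\sum_{\mathbf{v}\in\xi}X_{\mathbf{v}}$. $N_n$ is the maximal weight among lattice animals of size (number of sites) $n$ containing the origin. Under the stated integral condition, $n^{-1}N_n$ converges almost surely to a non-random finite constant, denoted $N$ (known result). With $B_n=\{0,\ldots,n-1\}^d$, $G_n=\max\{S(\xi):\xi\text{ a lattice animal},\ \xi\subseteq B_n\}$. *)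

theory Defs
  imports "HOL-Probability.Probability"
begin

text \<open>The lattice $\mathbb{Z}^d$ is the type \<open>int ^ 'd\<close>, with $d$ the cardinality of \<open>'d\<close>.\<close>

definition nearest_neighbour :: "int ^ 'd::finite \<Rightarrow> int ^ 'd \<Rightarrow> bool" where
  "nearest_neighbour u v \<longleftrightarrow> (\<Sum>i\<in>UNIV. \<bar>u $ i - v $ i\<bar>) = 1"

definition lattice_connected :: "(int ^ 'd::finite) set \<Rightarrow> bool" where
  "lattice_connected \<xi> \<longleftrightarrow>
     (\<forall>u\<in>\<xi>. \<forall>v\<in>\<xi>. (u, v) \<in> {(a, b). a \<in> \<xi> \<and> b \<in> \<xi> \<and> nearest_neighbour a b}\<^sup>*)"

definition lattice_animal :: "(int ^ 'd::finite) set \<Rightarrow> bool" where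
  "lattice_animal \<xi> \<longleftrightarrow> finite \<xi> \<and> \<xi> \<noteq> {} \<and> lattice_connected \<xi>"

definition animal_weight :: "(int ^ 'd::finite \<Rightarrow> real) \<Rightarrow> (int ^ 'd) set \<Rightarrow> real" where
  "animal_weight x \<xi> = (\<Sum>v\<in>\<xi>. x v)"

text \<open>The next two are maxima over finite sets of animals, which are non-empty for
  \<open>n \<ge> 1\<close>; the value at \<open>n = 0\<close> is unspecified. The argument \<open>x\<close> is one realisation
  of the site weights.\<close>

definition max_weight_size :: "(int ^ 'd::finite \<Rightarrow> real) \<Rightarrow> nat \<Rightarrow> real" where
  "max_weight_size x n =
     Max (animal_weight x ` {\<xi>. lattice_animal \<xi> \<and> card \<xi> = n \<and> 0 \<in> \<xi>})"

definition lattice_box :: "nat \<Rightarrow> (int ^ 'd::finite) set" where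
  "lattice_box n = {v. \<forall>i. v $ i \<in> {0..<int n}}"

definition max_weight_box :: "(int ^ 'd::finite \<Rightarrow> real) \<Rightarrow> nat \<Rightarrow> real" where
  "max_weight_box x n =
     Max (animal_weight x ` {\<xi>. lattice_animal \<xi> \<and> \<xi> \<subseteq> lattice_box n})"

text \<open>A relation rather than a definite description: existence of the almost sure limit is
  a theorem about suitable weight distributions, and uniqueness holds on any probability
  space.\<close>

definition animal_growth_constant ::
    "'a measure \<Rightarrow> (int ^ 'd::finite \<Rightarrow> 'a \<Rightarrow> real) \<Rightarrow> real \<Rightarrow> bool" where
  "animal_growth_constant M X N \<longleftrightarrow>
     (AE \<omega> in M. (\<lambda>n. max_weight_size (\<lambda>v. X v \<omega>) n / real n) \<longlonglongrightarrow> N)"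

end

theory Submission
  imports Defs "HOL-Real_Asymp.Real_Asymp"
begin

text \<open>Let \<open>d\<close> be the dimension. Suppose that most boxes of side \<open>R\<close> contained an animal whose weight
  exceeds a large multiple of \<open>R\<close>, and that the animals of adjacent boxes could be joined at a cost
  of order \<open>R\<close>. An infinite cluster of such boxes would then carry a positive weight per site, and
  the growth constant would be positive. So at growth constant zero a box of side \<open>R\<close> fails, with
  probability bounded below, to contain an animal of weight \<open>t\<close> of order \<open>R\<close>. Such a box contains
  about \<open>(R / n)\<^sup>d\<close> disjoint boxes of side \<open>n\<close>, which are independent, and all of them must fail;
  hence a box of side \<open>n\<close> contains an animal of weight \<open>t\<close> with probability at most a constant times
  \<open>(n / R)\<^sup>d\<close> (\<open>no_growth_no_heavy\<close>). For \<open>n = 2\<^sup>m\<close> and \<open>t = \<epsilon> n m\<^sup>c\<close> this is summable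
  in \<open>m\<close> (\<open>pr_heavy_box_rate\<close>), and since the maximal weight in a box increases with the box, the
  Borel--Cantelli lemma along powers of two gives the theorem.

  The joining is delicate because the weights may be very negative with no control on their lower
  tail. Only sites of weight at least \<open>- K\<close> are used for it, where \<open>K\<close> makes the other sites rare. They are
  organised in a hierarchy of cubic cells: a cell of level \<open>j + 1\<close> is made of \<open>(S j)\<^sup>d\<close> cells of
  level \<open>j\<close> and is good if at most one of these is bad. The probability of being bad is essentially
  squared at each level (\<open>pr_bad\<close>). On the other hand one bad cell can be circumvented in dimension
  at least two by a detour of bounded length (\<open>detour\<close>), so that the hubs of two adjacent good cells
  of level \<open>k\<close> are joined by a path of length \<open>\<Prod>i<k. S i + 8\<close> (\<open>link_hubs\<close>), to be compared with
  the side \<open>\<Prod>i<k. S i\<close> of the cells. With \<open>S j = A * (j + 1)\<close> the two differ by a factor of at most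
  \<open>(k + 1) powr (16 / A)\<close>, and consecutive sides differ by a factor \<open>A * (k + 1)\<close>. As \<open>k\<close> is at most of the
  order of \<open>m\<close>, the admissible \<open>R\<close> is at least of order \<open>n * m powr (c - 1 - 16 / A)\<close>. The resulting
  probability has order \<open>m powr (- d * (c - 1 - 16 / A))\<close>, and for \<open>c > d / (d - 1)\<close> and large \<open>A\<close>
  the exponent is at most \<open>- d / (d - 1)\<close>, which is below \<open>- 1\<close>.

  A heavy animal must also be attached to this network, although it was selected by looking at the
  weights and may be surrounded by bad sites. Reveal the sites in decreasing order of one
  coordinate. The site \<open>v\<close> that completes the first heavy animal belongs to it, and nothing is known
  yet about the sites with a smaller value of that coordinate. A ladder of good cells of increasing level,
  all on that unexplored side, leads from the neighbour of \<open>v\<close> to the network; it is independent of the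
  exploration and is missing only with small probability (\<open>pr_heavy_not_laddered\<close>).

  Finally, the hierarchy is used a second time, with the boxes of side \<open>R\<close> in place of sites, to
  produce the infinite cluster (\<open>nested_cells_good_cluster\<close>, \<open>pr_nested_cells_good\<close>).\<close>

section \<open>Nearest-neighbour linking\<close>

lemma nearest_neighbour_sym: "nearest_neighbour u v \<longleftrightarrow> nearest_neighbour v u"
  by (simp add: nearest_neighbour_def abs_minus_commute)

lemma nearest_neighbour_axis: "nearest_neighbour v (v + axis i 1)"
proof -
  have "(\<Sum>j\<in>UNIV. \<bar>v $ j - (v + axis i 1) $ j\<bar>) = (\<Sum>j\<in>UNIV. if j = i then 1 else 0)"
    by (intro sum.cong) (auto simp: axis_def)
  then show ?thesis by (simp add: nearest_neighbour_def)
qed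

lemma nearest_neighbour_cases:
  assumes "nearest_neighbour u v"
  obtains i where "v = u + axis i 1" | i where "u = v + axis i 1"
proof -
  have s: "(\<Sum>j\<in>UNIV. \<bar>u $ j - v $ j\<bar>) = 1"
    using assms by (simp add: nearest_neighbour_def)
  then obtain i where i: "u $ i \<noteq> v $ i"
    by (metis (mono_tags, lifting) abs_zero eq_iff_diff_eq_0 sum.neutral zero_neq_one)
  have "1 = \<bar>u $ i - v $ i\<bar> + (\<Sum>j\<in>UNIV - {i}. \<bar>u $ j - v $ j\<bar>)"
    using s by (subst (asm) sum.remove[of _ i]) auto
  moreover have "(\<Sum>j\<in>UNIV - {i}. \<bar>u $ j - v $ j\<bar>) \<ge> 0"
    by (intro sum_nonneg) auto
  ultimately have one: "\<bar>u $ i - v $ i\<bar> = 1" and "(\<Sum>j\<in>UNIV - {i}. \<bar>u $ j - v $ j\<bar>) = 0"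
    using i by linarith+
  then have "\<forall>j\<in>UNIV - {i}. u $ j = v $ j"
    by (subst (asm) sum_nonneg_eq_0_iff) auto
  then have "v = u + axis i 1 \<or> u = v + axis i 1"
    using one by (auto simp: vec_eq_iff axis_def abs_if split: if_splits)
  then show ?thesis using that by blast
qed

lemma card_nearest_neighbours:
  fixes u :: "int ^ 'd::finite"
  shows "finite {v. nearest_neighbour u v}" "card {v. nearest_neighbour u v} \<le> 2 * CARD('d)"
proof -
  let ?N = "(\<lambda>i. u + axis i 1) ` UNIV \<union> (\<lambda>i. u - axis i 1) ` UNIV"
  have sub: "{v. nearest_neighbour u v} \<subseteq> ?N"
    by (auto elim!: nearest_neighbour_cases)
  show "finite {v. nearest_neighbour u v}" by (rule finite_subset[OF sub]) auto
  have "card {v. nearest_neighbour u v} \<le> card ?N" by (rule card_mono[OF _ sub]) auto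
  also have "\<dots> \<le> card ((\<lambda>i. u + axis i 1) ` UNIV) + card ((\<lambda>i. u - axis i 1) ` UNIV)"
    by (rule card_Un_le)
  also have "\<dots> \<le> CARD('d) + CARD('d)"
    by (intro add_mono card_image_le) auto
  finally show "card {v. nearest_neighbour u v} \<le> 2 * CARD('d)" by simp
qed

text \<open>One move of a path inside \<open>V\<close> through sites satisfying \<open>g\<close>. Standing still is a move, so that
  \<open>step V g ^^ m\<close> describes paths of length at most \<open>m\<close> and increases with \<open>m\<close>.\<close>

definition step :: "(int ^ 'd::finite) set \<Rightarrow> (int ^ 'd \<Rightarrow> bool) \<Rightarrow> ((int ^ 'd) \<times> (int ^ 'd)) set" where
  "step V g = {(a, b). a \<in> V \<and> b \<in> V \<and> g a \<and> g b \<and> nearest_neighbour a b}\<^sup>="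

lemma relpow_step_refl: "(a, a) \<in> step V g ^^ n"
  by (induction n) (auto simp: step_def)

lemma relpow_step_mono:
  assumes "(a, b) \<in> step V g ^^ m" "V \<subseteq> W" "\<And>v. v \<in> V \<Longrightarrow> g v \<Longrightarrow> h v" "m \<le> n"
  shows "(a, b) \<in> step W h ^^ n"
proof -
  have "(a, b) \<in> step W h ^^ m"
    using assms(1)
  proof (induction m arbitrary: b)
    case (Suc m)
    then obtain c where c: "(a, c) \<in> step V g ^^ m" "(c, b) \<in> step V g" by auto
    have "(c, b) \<in> step W h" using c(2) assms(2,3) by (auto simp: step_def)
    then show ?case by (rule relpow_Suc_I[OF Suc.IH[OF c(1)]])
  qed simp
  moreover have "(b, b) \<in> step W h ^^ k" for k by (rule relpow_step_refl)
  ultimately have "(a, b) \<in> step W h ^^ (m + (n - m))"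
    by (auto simp: relpow_add)
  then show ?thesis using assms(4) by simp
qed

lemma relpow_step_trans:
  assumes "(a, b) \<in> step V g ^^ m" "(b, c) \<in> step V g ^^ n"
  shows "(a, c) \<in> step V g ^^ (m + n)"
  using assms by (auto simp: relpow_add)

lemma relpow_step_sym:
  assumes "(a, b) \<in> step V g ^^ m"
  shows "(b, a) \<in> step V g ^^ m"
proof -
  have sym: "(y, x) \<in> step V g" if "(x, y) \<in> step V g" for x y
    using that nearest_neighbour_sym[of x y] by (auto simp: step_def)
  show ?thesis using assms
  proof (induction m arbitrary: b)
    case (Suc m)
    then obtain c where "(a, c) \<in> step V g ^^ m" "(c, b) \<in> step V g" by auto
    then show ?case using relpow_Suc_I2[OF sym Suc.IH] by blast
  qed simp
qed

lemma relpow_step_last: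
  assumes "(a, b) \<in> step V g ^^ m" "a \<in> V" "g a"
  shows "b \<in> V \<and> g b"
  using assms(1)
proof (induction m arbitrary: b)
  case (Suc m)
  then obtain c where "(a, c) \<in> step V g ^^ m" "(c, b) \<in> step V g" by auto
  then show ?case using Suc.IH[of c] by (auto simp: step_def)
qed (use assms in simp)

lemma lattice_connected_Un:
  assumes "lattice_connected A" "lattice_connected B" "c \<in> A" "c \<in> B"
  shows "lattice_connected (A \<union> B)"
proof -
  let ?r = "\<lambda>\<xi>. {(a, b). a \<in> \<xi> \<and> b \<in> \<xi> \<and> nearest_neighbour a b}"
  have A: "(u, v) \<in> (?r (A \<union> B))\<^sup>*" if "u \<in> A" "v \<in> A" for u v
    using assms(1) that rtrancl_mono[of "?r A" "?r (A \<union> B)"] by (auto simp: lattice_connected_def)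
  have B: "(u, v) \<in> (?r (A \<union> B))\<^sup>*" if "u \<in> B" "v \<in> B" for u v
    using assms(2) that rtrancl_mono[of "?r B" "?r (A \<union> B)"] by (auto simp: lattice_connected_def)
  show ?thesis unfolding lattice_connected_def
  proof (intro ballI)
    fix u v assume "u \<in> A \<union> B" "v \<in> A \<union> B"
    then have "(u, c) \<in> (?r (A \<union> B))\<^sup>*" "(c, v) \<in> (?r (A \<union> B))\<^sup>*"
      using A[of u c] A[of c v] B[of u c] B[of c v] assms(3,4) by blast+
    then show "(u, v) \<in> (?r (A \<union> B))\<^sup>*" by (rule rtrancl_trans)
  qed
qed

lemma lattice_connected_edge:
  assumes "nearest_neighbour a b"
  shows "lattice_connected {a, b}"
  using assms nearest_neighbour_sym[of a b]
  by (auto simp: lattice_connected_def intro!: r_into_rtrancl)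

lemma lattice_connected_singleton [simp]: "lattice_connected {a}"
  by (simp add: lattice_connected_def)

text \<open>If neighbouring members of a family of connected sets meet, a chain of indices can be followed
  site by site through the members, so the union is connected.\<close>

lemma lattice_connected_UN:
  assumes conn: "\<And>z z'. z \<in> \<Gamma> \<Longrightarrow> z' \<in> \<Gamma> \<Longrightarrow> (z, z') \<in> {(a, b). a \<in> \<Gamma> \<and> b \<in> \<Gamma> \<and> r a b}\<^sup>*"
    and A: "\<And>z. z \<in> \<Gamma> \<Longrightarrow> lattice_connected (A z)"
    and meet: "\<And>z z'. z \<in> \<Gamma> \<Longrightarrow> z' \<in> \<Gamma> \<Longrightarrow> r z z' \<Longrightarrow> A z \<inter> A z' \<noteq> {}"
  shows "lattice_connected (\<Union>z\<in>\<Gamma>. A z)"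
proof -
  let ?r = "\<lambda>\<xi>. {(a, b). a \<in> \<xi> \<and> b \<in> \<xi> \<and> nearest_neighbour a b}"
  let ?U = "\<Union>z\<in>\<Gamma>. A z"
  have loc: "(u, v) \<in> (?r ?U)\<^sup>*" if "z \<in> \<Gamma>" "u \<in> A z" "v \<in> A z" for z u v
  proof -
    have "(u, v) \<in> (?r (A z))\<^sup>*" using A[OF that(1)] that by (auto simp: lattice_connected_def)
    then show ?thesis using rtrancl_mono[of "?r (A z)" "?r ?U"] that(1) by blast
  qed
  have "\<forall>v\<in>A z'. (u, v) \<in> (?r ?U)\<^sup>*" if u: "u \<in> A z" "z \<in> \<Gamma>"
    and zz': "(z, z') \<in> {(a, b). a \<in> \<Gamma> \<and> b \<in> \<Gamma> \<and> r a b}\<^sup>*" for u z z'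
    using zz'
  proof (induction rule: rtrancl_induct)
    case base
    then show ?case using loc u by blast
  next
    case (step y z')
    then obtain w where w: "w \<in> A y" "w \<in> A z'" using meet[of y z'] by blast
    show ?case
    proof
      fix v assume v: "v \<in> A z'"
      have "(w, v) \<in> (?r ?U)\<^sup>*" using loc[of z' w v] step.hyps w v by auto
      then show "(u, v) \<in> (?r ?U)\<^sup>*" using step.IH w by (meson rtrancl_trans)
    qed
  qed
  then have "(u, v) \<in> (?r ?U)\<^sup>*" if "z \<in> \<Gamma>" "z' \<in> \<Gamma>" "u \<in> A z" "v \<in> A z'" for u v z z'
    using conn[OF that(1,2)] that by blast
  then show ?thesis unfolding lattice_connected_def by (simp only: UN_iff) blast
qed

lemma lattice_connected_UN_common:
  assumes "\<And>i. i \<in> I \<Longrightarrow> lattice_connected (A i)" "\<And>i. i \<in> I \<Longrightarrow> c \<in> A i"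
  shows "lattice_connected (\<Union>i\<in>I. A i)"
proof (rule lattice_connected_UN[where r = "\<lambda>_ _. True"])
  show "A i \<inter> A j \<noteq> {}" if "i \<in> I" "j \<in> I" for i j
    using assms(2)[OF that(1)] assms(2)[OF that(2)] by blast
qed (use assms(1) in auto)

text \<open>Paths bound lengths, animals are sets: this turns the former into the latter.\<close>

lemma relpow_step_connected_set:
  assumes "(a, b) \<in> step V g ^^ m" "a \<in> V" "g a"
  obtains T where "finite T" "lattice_connected T" "a \<in> T" "b \<in> T" "T \<subseteq> V" "\<And>v. v \<in> T \<Longrightarrow> g v"
    "card T \<le> m + 1"
proof -
  have "\<exists>T. finite T \<and> lattice_connected T \<and> a \<in> T \<and> b \<in> T \<and> T \<subseteq> V \<and> (\<forall>v\<in>T. g v) \<and> card T \<le> m + 1"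
    using assms(1)
  proof (induction m arbitrary: b)
    case 0
    then show ?case using assms(2,3) by (intro exI[of _ "{a}"]) auto
  next
    case (Suc m)
    then obtain c where c: "(a, c) \<in> step V g ^^ m" "(c, b) \<in> step V g" by auto
    obtain T where T: "finite T" "lattice_connected T" "a \<in> T" "c \<in> T" "T \<subseteq> V" "\<forall>v\<in>T. g v" "card T \<le> m + 1"
      using Suc.IH[OF c(1)] by auto
    show ?case
    proof (cases "c = b")
      case True
      then show ?thesis using T by auto
    next
      case False
      then have cb: "b \<in> V" "g b" "nearest_neighbour c b" using c(2) by (auto simp: step_def)
      have "lattice_connected (T \<union> {c, b})"
        using T lattice_connected_edge[OF cb(3)] by (intro lattice_connected_Un[where c = c]) auto
      then have "lattice_connected (insert b T)" using T(4) by (simp add: insert_absorb insert_commute)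
      then show ?thesis using T cb
        by (intro exI[of _ "insert b T"]) (auto simp: card_insert_if)
    qed
  qed
  then show ?thesis using that by blast
qed

text \<open>The smallest box containing \<open>a\<close> and \<open>b\<close>. Any coordinatewise monotone path from \<open>a\<close> to \<open>b\<close>
  stays in it.\<close>

definition orthotope :: "int ^ 'd::finite \<Rightarrow> int ^ 'd \<Rightarrow> (int ^ 'd) set" where
  "orthotope a b = {w. \<forall>i. min (a $ i) (b $ i) \<le> w $ i \<and> w $ i \<le> max (a $ i) (b $ i)}"

lemma route:
  assumes "orthotope a b \<subseteq> V" "\<And>w. w \<in> orthotope a b \<Longrightarrow> g w" "(\<Sum>i\<in>UNIV. \<bar>a $ i - b $ i\<bar>) \<le> int m"
  shows "(a, b) \<in> step V g ^^ m"
  using assms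
proof (induction m arbitrary: a)
  case 0
  then have "(\<Sum>i\<in>UNIV. \<bar>a $ i - b $ i\<bar>) = 0" by (intro antisym sum_nonneg) auto
  then have "a = b" by (subst (asm) sum_nonneg_eq_0_iff) (auto simp: vec_eq_iff)
  then show ?case by simp
next
  case (Suc m)
  show ?case
  proof (cases "a = b")
    case True
    then show ?thesis by (simp only: relpow_step_refl)
  next
    case False
    then obtain i where i: "a $ i \<noteq> b $ i" by (auto simp: vec_eq_iff)
    define a' where "a' = (if a $ i < b $ i then a + axis i 1 else a - axis i 1)"
    have comp: "a' $ j = (if j = i then (if a $ i < b $ i then a $ i + 1 else a $ i - 1) else a $ j)" for j
      by (auto simp: a'_def axis_def)
    have nn: "nearest_neighbour a a'"
      using nearest_neighbour_axis[of a i] nearest_neighbour_axis[of "a - axis i 1" i] nearest_neighbour_sym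
      by (auto simp: a'_def)
    have a': "a' \<in> orthotope a b" "a \<in> orthotope a b" using i by (auto simp: orthotope_def comp)
    have sub: "orthotope a' b \<subseteq> orthotope a b"
    proof
      fix w assume w: "w \<in> orthotope a' b"
      show "w \<in> orthotope a b" unfolding orthotope_def
      proof (safe)
        fix j
        show "min (a $ j) (b $ j) \<le> w $ j"
          using w i by (cases "j = i") (auto simp: orthotope_def comp dest!: spec[of _ j] split: if_splits)
        show "w $ j \<le> max (a $ j) (b $ j)"
          using w i by (cases "j = i") (auto simp: orthotope_def comp dest!: spec[of _ j] split: if_splits)
      qed
    qed
    have "(\<Sum>j\<in>UNIV. \<bar>a $ j - b $ j\<bar>) = \<bar>a $ i - b $ i\<bar> + (\<Sum>j\<in>UNIV - {i}. \<bar>a $ j - b $ j\<bar>)"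
      by (subst sum.remove[of _ i]) auto
    moreover have "(\<Sum>j\<in>UNIV. \<bar>a' $ j - b $ j\<bar>) = \<bar>a' $ i - b $ i\<bar> + (\<Sum>j\<in>UNIV - {i}. \<bar>a $ j - b $ j\<bar>)"
      by (subst sum.remove[of _ i]) (auto simp: comp)
    moreover have "\<bar>a' $ i - b $ i\<bar> = \<bar>a $ i - b $ i\<bar> - 1" using i by (auto simp: comp)
    ultimately have "(\<Sum>j\<in>UNIV. \<bar>a' $ j - b $ j\<bar>) \<le> int m" using Suc.prems(3) by linarith
    then have "(a', b) \<in> step V g ^^ m" using Suc.prems sub by (intro Suc.IH) auto
    moreover have "(a, a') \<in> step V g" using a' Suc.prems nn by (auto simp: step_def)
    ultimately show ?thesis by (meson relpow_Suc_I2)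
  qed
qed

section \<open>Cells and scales\<close>

text \<open>The index of the cube of side \<open>l\<close> that contains \<open>v\<close>; \<open>cell l z\<close> is then the cube with index \<open>z\<close>.\<close>

definition coarse :: "nat \<Rightarrow> int ^ 'd::finite \<Rightarrow> int ^ 'd" where
  "coarse l v = (\<chi> i. v $ i div int l)"

definition cell :: "nat \<Rightarrow> int ^ 'd::finite \<Rightarrow> (int ^ 'd) set" where
  "cell l z = {v. coarse l v = z}"

lemma coarse_nth [simp]: "coarse l v $ i = v $ i div int l"
  by (simp add: coarse_def)

lemma coarse_coarse: "coarse s (coarse l v) = coarse (l * s) v"
  by (simp add: vec_eq_iff zdiv_zmult2_eq)

lemma mem_cell_coarse [simp]: "v \<in> cell l (coarse l v)"
  by (simp add: cell_def)

lemma cell_disjoint: "z \<noteq> z' \<Longrightarrow> cell l z \<inter> cell l z' = {}"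
  by (auto simp: cell_def)

lemma cell_subset_cell_mult: "y \<in> cell s z \<Longrightarrow> cell l y \<subseteq> cell (l * s) z"
  by (auto simp: cell_def coarse_coarse)

lemma div_eq_int_iff:
  fixes v z :: int
  assumes "l > (0::nat)"
  shows "v div int l = z \<longleftrightarrow> int l * z \<le> v \<and> v < int l * z + int l"
proof -
  have "v div int l = z" if "int l * z \<le> v" "v < int l * z + int l"
    using int_div_pos_eq[of v "int l" z "v - int l * z"] that by auto
  moreover have "int l * (v div int l) \<le> v \<and> v < int l * (v div int l) + int l"
    using assms by (metis mult_div_mod_eq of_nat_0_less_iff pos_mod_bound pos_mod_sign
        add_less_cancel_left le_add_same_cancel1)
  ultimately show ?thesis by blast
qed

lemma mem_cell_iff:
  assumes "l > 0"
  shows "v \<in> cell l z \<longleftrightarrow> (\<forall>i. int l * z $ i \<le> v $ i \<and> v $ i < int l * z $ i + int l)"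
  by (simp add: cell_def vec_eq_iff div_eq_int_iff[OF assms])

lemma cell_1 [simp]: "cell (Suc 0) z = {z}"
  by (auto simp: cell_def vec_eq_iff)

lemma finite_card_orthotope_product:
  fixes lo hi :: "'d::finite \<Rightarrow> int"
  shows "finite {v :: int ^ 'd. \<forall>i. lo i \<le> v $ i \<and> v $ i < hi i}"
    and "card {v :: int ^ 'd. \<forall>i. lo i \<le> v $ i \<and> v $ i < hi i} = (\<Prod>i\<in>UNIV. nat (hi i - lo i))"
proof -
  let ?F = "\<Pi>\<^sub>E i\<in>UNIV. {lo i..<hi i}"
  have eq: "{v :: int ^ 'd. \<forall>i. lo i \<le> v $ i \<and> v $ i < hi i} = vec_lambda ` ?F" (is "?V = _")
  proof
    show "?V \<subseteq> vec_lambda ` ?F"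
    proof
      fix v assume "v \<in> ?V"
      then show "v \<in> vec_lambda ` ?F"
        by (intro image_eqI[of _ _ "\<lambda>i. v $ i"]) (auto simp: PiE_def)
    qed
  qed (auto simp: PiE_def Pi_def)
  have fin: "finite ?F" by (intro finite_PiE) auto
  then show "finite ?V" unfolding eq by simp
  have "inj_on vec_lambda ?F" by (auto simp: inj_on_def vec_lambda_inject)
  then show "card ?V = (\<Prod>i\<in>UNIV. nat (hi i - lo i))"
    unfolding eq by (simp add: card_image card_PiE)
qed

lemma finite_cell:
  assumes "l > 0" shows "finite (cell l z)"
proof -
  have "cell l z = {v. \<forall>i. int l * z $ i \<le> v $ i \<and> v $ i < int l * z $ i + int l}"
    by (auto simp: mem_cell_iff[OF assms])
  then show ?thesis by (simp only: finite_card_orthotope_product)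
qed

lemma card_cell:
  assumes "l > 0" shows "card (cell l (z :: int ^ 'd::finite)) = l ^ CARD('d)"
proof -
  have "cell l z = {v. \<forall>i. int l * z $ i \<le> v $ i \<and> v $ i < int l * z $ i + int l}"
    by (auto simp: mem_cell_iff[OF assms])
  then show ?thesis by (simp add: finite_card_orthotope_product)
qed

lemma orthotope_subset_cell:
  assumes "a \<in> cell l z" "b \<in> cell l z" "l > 0"
  shows "orthotope a b \<subseteq> cell l z"
proof
  fix w assume w: "w \<in> orthotope a b"
  show "w \<in> cell l z" unfolding mem_cell_iff[OF assms(3)]
  proof
    fix i
    show "int l * z $ i \<le> w $ i \<and> w $ i < int l * z $ i + int l"
      using assms(1,2) w unfolding mem_cell_iff[OF assms(3)] orthotope_def
      by (smt (verit, best) mem_Collect_eq)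
  qed
qed

lemma route_in_cell:
  fixes a b :: "int ^ 'd::finite"
  assumes "a \<in> cell l z" "b \<in> cell l z" "l > 0" "\<And>w. w \<in> cell l z \<Longrightarrow> g w"
  shows "(a, b) \<in> step (cell l z) g ^^ (CARD('d) * l)"
proof (rule route)
  show "orthotope a b \<subseteq> cell l z" using assms orthotope_subset_cell by blast
  then show "\<And>w. w \<in> orthotope a b \<Longrightarrow> g w" using assms(4) by blast
  have "(\<Sum>i\<in>UNIV. \<bar>a $ i - b $ i\<bar>) \<le> (\<Sum>i\<in>(UNIV::'d set). int l)"
    using assms(1,2) unfolding mem_cell_iff[OF assms(3)] by (intro sum_mono) (smt (verit))
  then show "(\<Sum>i\<in>UNIV. \<bar>a $ i - b $ i\<bar>) \<le> int (CARD('d) * l)" by simp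
qed

lemma axis_apply: "axis k t $ j = (if j = k then t else 0)"
  by (simp add: axis_def)

section \<open>Detours around bad cells\<close>

text \<open>Here \<open>g\<close> is a property of the subcells, indexed by lattice points; the cell \<open>z\<close> at the next
  level consists of the subcells with index in \<open>cell s z\<close>.\<close>

definition at_most_one_bad :: "nat \<Rightarrow> (int ^ 'd::finite \<Rightarrow> bool) \<Rightarrow> int ^ 'd \<Rightarrow> bool" where
  "at_most_one_bad s g z \<longleftrightarrow> (\<forall>y\<in>cell s z. \<forall>y'\<in>cell s z. \<not> g y \<longrightarrow> \<not> g y' \<longrightarrow> y = y')"

text \<open>A subcell that has a margin of two subcells inside its cell, which leaves room for detours when
  \<open>s \<ge> 5\<close>.\<close>

definition anchor :: "nat \<Rightarrow> int ^ 'd::finite \<Rightarrow> int ^ 'd" where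
  "anchor s z = (\<chi> i. int s * z $ i + 2)"

text \<open>The representative of a cell: its anchor or, if the anchor is bad, a neighbour of the anchor,
  which is then good if no second subcell is bad.\<close>

definition pick :: "'d::finite \<Rightarrow> nat \<Rightarrow> (int ^ 'd \<Rightarrow> bool) \<Rightarrow> int ^ 'd \<Rightarrow> int ^ 'd" where
  "pick m s g z = (if g (anchor s z) then anchor s z else anchor s z + axis m 1)"

lemma near_anchor_in_cell:
  assumes "s \<ge> 5" "\<And>i. \<bar>v $ i - anchor s z $ i\<bar> \<le> 2"
  shows "v \<in> cell s z"
proof -
  have s: "s > 0" using assms(1) by simp
  show ?thesis unfolding mem_cell_iff[OF s]
  proof
    fix i show "int s * z $ i \<le> v $ i \<and> v $ i < int s * z $ i + int s"
      using assms(2)[of i] assms(1) by (auto simp: anchor_def)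
  qed
qed

lemma pick_in_cell: "s \<ge> 5 \<Longrightarrow> pick m s g z \<in> cell s z"
  by (rule near_anchor_in_cell) (auto simp: pick_def axis_def)

lemma pick_good:
  assumes "s \<ge> 5" "at_most_one_bad s g z" shows "g (pick m s g z)"
proof -
  have "anchor s z \<in> cell s z" "anchor s z + axis m 1 \<in> cell s z"
    by (rule near_anchor_in_cell[OF assms(1)]; auto simp: axis_def)+
  moreover have "anchor s z + axis m 1 \<noteq> anchor s z" by (auto simp: vec_eq_iff axis_def)
  ultimately show ?thesis using assms(2) unfolding pick_def at_most_one_bad_def by metis
qed

text \<open>The row in question passes through the anchor shifted by \<open>t\<close> in direction \<open>k\<close>. If the anchor
  is good, it lies on the row or next to it. If not, everything else in the cell is good, and one can walk around the
  anchor in the plane of \<open>i\<close> and \<open>k\<close>, which contains the picked neighbour since \<open>m\<close> is \<open>i\<close> or \<open>k\<close>.\<close>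

lemma pick_to_row:
  fixes z :: "int ^ 'd::finite"
  assumes s: "s \<ge> 5" and lone: "at_most_one_bad s g z" and ik: "i \<noteq> k" and m: "i = m \<or> k = m"
    and t: "t \<in> {-1, 0, 1}" and row: "g (anchor s z + axis k t)"
  shows "(pick m s g z, anchor s z + axis k t) \<in> step (cell s z) g ^^ 4"
proof (cases "g (anchor s z)")
  case True
  have "(anchor s z, anchor s z + axis k t) \<in> step (cell s z) g ^^ 1"
  proof (rule route)
    have sub: "w = anchor s z \<or> w = anchor s z + axis k t" 
      if "w \<in> orthotope (anchor s z) (anchor s z + axis k t)" for w
    proof (cases "w $ k = anchor s z $ k")
      case True
      then have "w = anchor s z" using that by (auto simp: orthotope_def vec_eq_iff axis_def split: if_splits) 
      then show ?thesis ..
    next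
      case False
      then have "w $ j = (anchor s z + axis k t) $ j" for j
        using that t by (cases "j = k") (auto simp: orthotope_def axis_def dest!: spec[of _ j])
      then show ?thesis by (auto simp: vec_eq_iff)
    qed
    show "orthotope (anchor s z) (anchor s z + axis k t) \<subseteq> cell s z"
      by (rule orthotope_subset_cell) (use s t in \<open>auto intro!: near_anchor_in_cell simp: axis_def\<close>)
    show "g w" if "w \<in> orthotope (anchor s z) (anchor s z + axis k t)" for w
      using sub[OF that] True row by auto
    have "(\<Sum>j\<in>UNIV. \<bar>anchor s z $ j - (anchor s z + axis k t) $ j\<bar>) = (\<Sum>j\<in>UNIV. if j = k then \<bar>t\<bar> else 0)"
      by (intro sum.cong) (auto simp: axis_def)
    then show "(\<Sum>j\<in>UNIV. \<bar>anchor s z $ j - (anchor s z + axis k t) $ j\<bar>) \<le> int 1"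
      using t by auto
  qed
  then have "(anchor s z, anchor s z + axis k t) \<in> step (cell s z) g ^^ 4"
    by (rule relpow_step_mono) auto
  then show ?thesis using True by (simp add: pick_def)
next
  case False
  have "anchor s z \<in> cell s z" by (rule near_anchor_in_cell[OF s]) auto
  then have others: "g y" if "y \<in> cell s z" "y \<noteq> anchor s z" for y
    using lone that False unfolding at_most_one_bad_def by metis
  have t0: "t = 1 \<or> t = -1" using t row False by (metis add.right_neutral axis_eq_0_iff insertE singletonD)
  define P where "P a b = anchor s z + axis i a + axis k b" for a b
  have P_nth: "P a b $ j = anchor s z $ j + (if j = i then a else if j = k then b else 0)" for a b j
    using ik by (auto simp: P_def axis_def)
  have P_cell: "P a b \<in> cell s z" if "\<bar>a\<bar> \<le> 2" "\<bar>b\<bar> \<le> 2" for a b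
    by (rule near_anchor_in_cell[OF s]) (use that in \<open>auto simp: P_nth\<close>)
  have P_ne: "P a b \<noteq> anchor s z" if "a \<noteq> 0 \<or> b \<noteq> 0" for a b
    using that ik by (auto simp: vec_eq_iff P_nth split: if_splits)
  have nn: "(P a b, P a' b') \<in> step (cell s z) g"
    if "\<bar>a\<bar> \<le> 2" "\<bar>b\<bar> \<le> 2" "\<bar>a'\<bar> \<le> 2" "\<bar>b'\<bar> \<le> 2" "a \<noteq> 0 \<or> b \<noteq> 0" "a' \<noteq> 0 \<or> b' \<noteq> 0"
      "\<bar>a - a'\<bar> + \<bar>b - b'\<bar> = 1" for a b a' b'
  proof -
    have "(\<Sum>j\<in>UNIV. \<bar>P a b $ j - P a' b' $ j\<bar>) 
        = (\<Sum>j\<in>UNIV. (if j = i then \<bar>a - a'\<bar> else 0) + (if j = k then \<bar>b - b'\<bar> else 0))"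
      using ik by (intro sum.cong) (auto simp: P_nth)
    then have "nearest_neighbour (P a b) (P a' b')"
      using that(7) by (simp add: nearest_neighbour_def sum.distrib)
    then show ?thesis
      using that P_cell P_ne others by (auto simp: step_def)
  qed
  have target: "anchor s z + axis k t = P 0 t" by (simp add: P_def vec_eq_iff axis_def)
  have chain: "(x, y) \<in> step (cell s z) g ^^ 4"
    if "(x, a) \<in> step (cell s z) g" "(a, b) \<in> step (cell s z) g" "(b, c) \<in> step (cell s z) g"
      "(c, y) \<in> step (cell s z) g" for x a b c y
    using that by (auto simp: numeral_eq_Suc)
  have refl: "(x, x) \<in> step (cell s z) g" for x by (simp add: step_def)
  show ?thesis
  proof (cases "i = m")
    case True
    then have "pick m s g z = P 1 0" using False by (simp add: pick_def P_def vec_eq_iff axis_def)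
    moreover have "(P 1 0, P 1 t) \<in> step (cell s z) g" "(P 1 t, P 0 t) \<in> step (cell s z) g"
      using t0 by (auto intro!: nn)
    ultimately show ?thesis unfolding target using chain refl by metis
  next
    case neq: False
    then have pick: "pick m s g z = P 0 1" using False m by (simp add: pick_def P_def vec_eq_iff axis_def)
    show ?thesis
    proof (cases "t = 1")
      case True
      then show ?thesis unfolding target pick using chain refl by metis
    next
      case t_ne: False
      then have "t = -1" using t0 by simp
      moreover have "(P 0 1, P 1 1) \<in> step (cell s z) g" "(P 1 1, P 1 0) \<in> step (cell s z) g"
        "(P 1 0, P 1 (-1)) \<in> step (cell s z) g" "(P 1 (-1), P 0 (-1)) \<in> step (cell s z) g"
        by (auto intro!: nn)
      ultimately show ?thesis unfolding target pick using chain by metis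
    qed
  qed
qed

text \<open>Of three parallel rows of subcells that run from one cell into the next, two bad subcells can block at most
  two. The free row has length \<open>s\<close>, and reaching it costs at most four moves at either end.
  The three rows are displaced in a direction \<open>k \<noteq> i\<close>, which is where the dimension enters.\<close>

lemma detour:
  fixes z :: "int ^ 'd::finite"
  assumes s: "s \<ge> 5" and d: "CARD('d) \<ge> 2"
    and lone: "at_most_one_bad s g z" "at_most_one_bad s g (z + axis i 1)"
  shows "(pick m s g z, pick m s g (z + axis i 1))
    \<in> step (cell s z \<union> cell s (z + axis i 1)) g ^^ (s + 8)"
proof -
  let ?z' = "z + axis i 1"
  let ?V = "cell s z \<union> cell s ?z'"
  have "\<exists>j::'d. j \<noteq> i"
  proof (rule ccontr)
    assume "\<not> ?thesis"
    then have "(UNIV :: 'd set) = {i}" by auto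
    then have "CARD('d) = card {i}" by simp
    then show False using d by simp
  qed
  then obtain k where ik: "i \<noteq> k" and m: "i = m \<or> k = m" by metis
  have anchor': "anchor s ?z' $ j = anchor s z $ j + (if j = i then int s else 0)" for j
    by (auto simp: anchor_def axis_def algebra_simps)
  let ?row = "\<lambda>t. orthotope (anchor s z + axis k t) (anchor s ?z' + axis k t)"
  have row_nth: "w $ k = anchor s z $ k + t" if "w \<in> ?row t" for w t
  proof -
    have "anchor s ?z' $ k = anchor s z $ k" using anchor'[of k] ik by simp
    then show ?thesis using that by (auto simp: orthotope_def axis_apply dest!: spec[of _ k])
  qed
  have row_sub: "w \<in> ?V" if w: "w \<in> ?row t" and t: "\<bar>t\<bar> \<le> 2" for w t
  proof -
    have s0: "s > 0" using s by simp
    have off: "w $ j = anchor s z $ j + (if j = k then t else 0)" if "j \<noteq> i" for j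
      using w that unfolding orthotope_def by (auto simp: anchor' axis_apply dest!: spec[of _ j])
    have on: "anchor s z $ i \<le> w $ i" "w $ i \<le> anchor s z $ i + int s"
      using w ik unfolding orthotope_def by (auto simp: anchor' axis_apply dest!: spec[of _ i])
    show ?thesis
    proof (cases "w $ i < int s * z $ i + int s")
      case True
      have "w \<in> cell s z" unfolding mem_cell_iff[OF s0]
      proof
        fix j show "int s * z $ j \<le> w $ j \<and> w $ j < int s * z $ j + int s"
          using True on off[of j] s t by (cases "j = i") (auto simp: anchor_def)
      qed
      then show ?thesis ..
    next
      case False
      have "w \<in> cell s ?z'" unfolding mem_cell_iff[OF s0]
      proof
        fix j show "int s * ?z' $ j \<le> w $ j \<and> w $ j < int s * ?z' $ j + int s"
          using False on off[of j] s t by (cases "j = i") (auto simp: anchor_def axis_def algebra_simps)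
      qed
      then show ?thesis ..
    qed
  qed
  \<comment> \<open>Three bad subcells in two cells would put two in the same cell.\<close>
  have "\<exists>t\<in>{-1, 0, 1}. \<forall>w\<in>?row t. g w"
  proof (rule ccontr)
    assume "\<not> ?thesis"
    then obtain w1 w2 w3 where w: "w1 \<in> ?row (-1)" "w2 \<in> ?row 0" "w3 \<in> ?row 1"
      and bad: "\<not> g w1" "\<not> g w2" "\<not> g w3" by blast
    have V: "w1 \<in> ?V" "w2 \<in> ?V" "w3 \<in> ?V" 
      using row_sub[OF w(1)] row_sub[OF w(2)] row_sub[OF w(3)] by simp_all
    have "w1 $ k \<noteq> w2 $ k" "w1 $ k \<noteq> w3 $ k" "w2 $ k \<noteq> w3 $ k" using w[THEN row_nth] by auto
    then have "w1 \<noteq> w2" "w1 \<noteq> w3" "w2 \<noteq> w3" by auto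
    then show False using V bad lone unfolding at_most_one_bad_def by blast
  qed
  then obtain t where t: "t \<in> {-1, 0, 1}" and good: "\<And>w. w \<in> ?row t \<Longrightarrow> g w" by blast
  have ends: "anchor s z + axis k t \<in> ?row t" "anchor s ?z' + axis k t \<in> ?row t"
    by (auto simp: orthotope_def)
  have 1: "(pick m s g z, anchor s z + axis k t) \<in> step ?V g ^^ 4"
    by (rule relpow_step_mono[OF pick_to_row[OF s lone(1) ik m t good[OF ends(1)]]]) auto
  have 3: "(pick m s g ?z', anchor s ?z' + axis k t) \<in> step ?V g ^^ 4"
    by (rule relpow_step_mono[OF pick_to_row[OF s lone(2) ik m t good[OF ends(2)]]]) auto
  have 2: "(anchor s z + axis k t, anchor s ?z' + axis k t) \<in> step ?V g ^^ s"
  proof (rule route)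
    have "\<bar>t\<bar> \<le> 2" using t by auto
    then show "?row t \<subseteq> ?V" by (intro subsetI row_sub)
    have "(\<Sum>j\<in>UNIV. \<bar>(anchor s z + axis k t) $ j - (anchor s ?z' + axis k t) $ j\<bar>)
        = (\<Sum>j\<in>UNIV. if j = i then int s else 0)"
      by (intro sum.cong) (auto simp: anchor')
    then show "(\<Sum>j\<in>UNIV. \<bar>(anchor s z + axis k t) $ j - (anchor s ?z' + axis k t) $ j\<bar>) \<le> int s"
      by simp
  qed (use good in auto)
  from relpow_step_trans[OF relpow_step_trans[OF 1 2] relpow_step_sym[OF 3]]
  show ?thesis by (simp add: add.commute)
qed

section \<open>The hierarchy of good cells\<close>

locale hierarchy =
  fixes S :: "nat \<Rightarrow> nat" and m :: "'d::finite"
  assumes S_ge: "S j \<ge> 5" and dim_ge: "CARD('d) \<ge> 2"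
begin

definition scale :: "nat \<Rightarrow> nat" where
  "scale j = (\<Prod>i<j. S i)"

text \<open>The length of the path that replaces one move between good cells of level \<open>j\<close> (\<open>link_hubs\<close>).\<close>

definition reach :: "nat \<Rightarrow> nat" where
  "reach j = (\<Prod>i<j. S i + 8)"

primrec good :: "(int ^ 'd \<Rightarrow> bool) \<Rightarrow> nat \<Rightarrow> int ^ 'd \<Rightarrow> bool" where
  "good g 0 = g"
| "good g (Suc j) = at_most_one_bad (S j) (good g j)"

primrec hub :: "(int ^ 'd \<Rightarrow> bool) \<Rightarrow> nat \<Rightarrow> int ^ 'd \<Rightarrow> int ^ 'd" where
  "hub g 0 z = z"
| "hub g (Suc j) z = hub g j (pick m (S j) (good g j) z)"

lemma scale_0 [simp]: "scale 0 = 1" and scale_Suc: "scale (Suc j) = scale j * S j"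
  by (simp_all add: scale_def)

lemma reach_0 [simp]: "reach 0 = 1" and reach_Suc: "reach (Suc j) = (S j + 8) * reach j"
  by (simp_all add: reach_def)

lemma S_pos [simp]: "S j > 0"
  using S_ge[of j] by simp

lemma scale_pos [simp]: "scale j > 0"
  by (auto simp: scale_def)

lemma hub_in_cell: "hub g j z \<in> cell (scale j) z"
proof (induction j arbitrary: z)
  case (Suc j)
  show ?case
    using Suc[of "pick m (S j) (good g j) z"]
      cell_subset_cell_mult[OF pick_in_cell[OF S_ge[of j], of m "good g j" z], of "scale j"]
    by (simp add: scale_Suc subset_iff)
qed simp

lemma good_hub: "good g j z \<Longrightarrow> g (hub g j z)"
proof (induction j arbitrary: z)
  case (Suc j)
  have "good g j (pick m (S j) (good g j) z)"
    using pick_good[OF S_ge[of j], of "good g j" z m] Suc.prems by simp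
  then show ?case using Suc.IH by simp
qed simp

text \<open>A move between good cells of level \<open>j + 1\<close> is replaced by \<open>S j + 8\<close> moves between good subcells
  (\<open>detour\<close>), and each of these by a path of sites inductively. The hubs are chosen per cell, not per pair
  of cells, so consecutive pieces fit together, and lengths multiply with no further constant.\<close>

lemma link_hubs:
  assumes "(y, y') \<in> step Y (good g j) ^^ n"
  shows "(hub g j y, hub g j y') \<in> step (\<Union>y\<in>Y. cell (scale j) y) g ^^ (n * reach j)"
proof -
  have many: "(hub g j y, hub g j y') \<in> step (\<Union>y\<in>Y. cell (scale j) y) g ^^ (n * reach j)"
    if one: "\<And>y y'. (y, y') \<in> step Y (good g j) \<Longrightarrow>
      (hub g j y, hub g j y') \<in> step (\<Union>y\<in>Y. cell (scale j) y) g ^^ reach j"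
      and path: "(y, y') \<in> step Y (good g j) ^^ n" for j n Y y y'
    using path
  proof (induction n arbitrary: y')
    case (Suc n)
    then obtain w where w: "(y, w) \<in> step Y (good g j) ^^ n" "(w, y') \<in> step Y (good g j)" by auto
    show ?case using relpow_step_trans[OF Suc.IH[OF w(1)] one[OF w(2)]] by (simp add: add.commute)
  qed simp
  have "(hub g j y, hub g j y') \<in> step (\<Union>y\<in>Y. cell (scale j) y) g ^^ reach j"
    if "(y, y') \<in> step Y (good g j)" for y y' Y
    using that
  proof (induction j arbitrary: y y' Y)
    case 0
    then show ?case by simp
  next
    case (Suc j)
    let ?V = "\<Union>y\<in>Y. cell (scale (Suc j)) y"
    have up: "(hub g (Suc j) y, hub g (Suc j) (y + axis i 1)) \<in> step ?V g ^^ reach (Suc j)"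
      if "y \<in> Y" "y + axis i 1 \<in> Y" "good g (Suc j) y" "good g (Suc j) (y + axis i 1)" for y i
    proof -
      let ?Y = "cell (S j) y \<union> cell (S j) (y + axis i 1)"
      have "(pick m (S j) (good g j) y, pick m (S j) (good g j) (y + axis i 1))
          \<in> step ?Y (good g j) ^^ (S j + 8)"
        using that by (intro detour[OF S_ge dim_ge]) auto
      from many[OF Suc.IH this]
      have "(hub g (Suc j) y, hub g (Suc j) (y + axis i 1))
          \<in> step (\<Union>y\<in>?Y. cell (scale j) y) g ^^ reach (Suc j)"
        by (simp add: reach_Suc)
      moreover have "(\<Union>y\<in>?Y. cell (scale j) y) \<subseteq> ?V"
        using that cell_subset_cell_mult[of _ "S j" _ "scale j"] unfolding scale_Suc by blast
      ultimately show ?thesis by (rule relpow_step_mono) auto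
    qed
    show ?case
    proof (cases "y = y'")
      case True
      then show ?thesis by (simp only: relpow_step_refl)
    next
      case False
      then have y: "y \<in> Y" "y' \<in> Y" "good g (Suc j) y" "good g (Suc j) y'" "nearest_neighbour y y'"
        using Suc.prems by (auto simp: step_def)
      from y(5) show ?thesis
      proof (cases rule: nearest_neighbour_cases)
        case (1 i)
        then show ?thesis using up y by blast
      next
        case (2 i)
        then show ?thesis using up[of y' i] y relpow_step_sym by blast
      qed
    qed
  qed
  then show ?thesis using many assms by blast
qed

end

context hierarchy
begin

subsection \<open>Ladders\<close>

text \<open>The subcells of level \<open>j\<close> to one side of \<open>v\<close>: in direction \<open>m\<close> they lie strictly below the subcell
  of \<open>v\<close>, within the cell of level \<open>j + 1\<close> of \<open>v\<close> or the one just below it. The second of these cells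
  is entirely contained in the block.\<close>

definition block :: "nat \<Rightarrow> int ^ 'd \<Rightarrow> (int ^ 'd) set" where
  "block j v = {y. coarse (S j) y \<in> {coarse (scale (Suc j)) v, coarse (scale (Suc j)) v - axis m 1}
     \<and> y $ m < coarse (scale j) v $ m}"

definition ladder :: "(int ^ 'd \<Rightarrow> bool) \<Rightarrow> nat \<Rightarrow> int ^ 'd \<Rightarrow> bool" where
  "ladder g k v \<longleftrightarrow> (\<forall>j<k. \<forall>y\<in>block j v. good g j y)"

lemma block_subset:
  "block j v \<subseteq> cell (S j) (coarse (scale (Suc j)) v) \<union> cell (S j) (coarse (scale (Suc j)) v - axis m 1)"
  by (auto simp: block_def cell_def)

lemma finite_block: "finite (block j v)"
  by (rule finite_subset[OF block_subset]) (simp add: finite_cell)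

lemma card_block: "card (block j v) \<le> 2 * S j ^ CARD('d)"
proof -
  have "card (block j v) \<le> card (cell (S j) (coarse (scale (Suc j)) v)
      \<union> cell (S j) (coarse (scale (Suc j)) v - axis m 1))"
    by (rule card_mono[OF _ block_subset]) (simp add: finite_cell)
  also have "\<dots> \<le> card (cell (S j) (coarse (scale (Suc j)) v))
      + card (cell (S j) (coarse (scale (Suc j)) v - axis m 1))"
    by (rule card_Un_le)
  finally show ?thesis by (simp add: card_cell)
qed

text \<open>The half-space that the ladder of \<open>v\<close> looks at does not contain \<open>v\<close>; this gives independence from
  anything observed at or above the height of \<open>v\<close>.\<close>

lemma block_below:
  assumes "y \<in> block j v" "w \<in> cell (scale j) y"
  shows "w $ m < v $ m"
proof (rule ccontr)
  assume "\<not> ?thesis"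
  then have "v $ m div int (scale j) \<le> w $ m div int (scale j)"
    by (intro zdiv_mono1) auto
  moreover have "w $ m div int (scale j) = y $ m"
    using assms(2) by (auto simp: cell_def)
  ultimately show False using assms(1) by (simp add: block_def)
qed

lemma good_all_cell:
  assumes "\<And>y. y \<in> cell (S k) z \<Longrightarrow> good g k y"
  shows "good g (Suc k) z" "hub g (Suc k) z = hub g k (anchor (S k) z)"
proof -
  show "good g (Suc k) z" using assms by (auto simp: at_most_one_bad_def)
  have "anchor (S k) z \<in> cell (S k) z" by (rule near_anchor_in_cell[OF S_ge]) auto
  then show "hub g (Suc k) z = hub g k (anchor (S k) z)" using assms by (simp add: pick_def)
qed

lemma neighbour_div_cases:
  fixes a :: int
  assumes "s > (0::nat)"
  shows "(a - 1) div int s \<in> {a div int s, a div int s - 1}"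
proof -
  have "(a - 1) div int s \<le> a div int s" by (intro zdiv_mono1) (use assms in auto)
  moreover have "(a - int s) div int s \<le> (a - 1) div int s" by (intro zdiv_mono1) (use assms in auto)
  moreover have "(a - int s) div int s = a div int s - 1"
    using div_mult_self1[of "int s" a "- 1"] assms by simp
  ultimately show ?thesis by auto
qed

text \<open>The index of the cell of level \<open>k\<close> next to that of \<open>v\<close>, on the side of smaller coordinates. The ladder of
  \<open>v\<close> passes through the hubs of these cells.\<close>

definition left :: "nat \<Rightarrow> int ^ 'd \<Rightarrow> int ^ 'd" where
  "left k v = coarse (scale k) v - axis m 1"

lemma coarse_left: "coarse (S k) (left k v) \<in> {coarse (scale (Suc k)) v, left (Suc k) v}"
proof -
  have *: "coarse (S k) (left k v) $ i = (if i = m then ((v $ m div int (scale k)) - 1) div int (S k)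
      else coarse (scale (Suc k)) v $ i)" for i
    by (auto simp: left_def axis_apply scale_Suc zdiv_zmult2_eq)
  have **: "v $ m div int (scale (Suc k)) = (v $ m div int (scale k)) div int (S k)"
    by (simp add: scale_Suc zdiv_zmult2_eq)
  from neighbour_div_cases[of "S k" "v $ m div int (scale k)"]
  have "coarse (S k) (left k v) $ m \<in> {coarse (scale (Suc k)) v $ m, left (Suc k) v $ m}"
    unfolding * by (simp add: left_def axis_apply **)
  moreover have "coarse (S k) (left k v) $ i = coarse (scale (Suc k)) v $ i"
    "coarse (S k) (left k v) $ i = left (Suc k) v $ i" if "i \<noteq> m" for i
    using that unfolding * by (auto simp: left_def axis_apply)
  ultimately show ?thesis by (simp add: vec_eq_iff) metis
qed

definition strip :: "nat \<Rightarrow> int ^ 'd \<Rightarrow> (int ^ 'd) set" where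
  "strip k v = cell (scale k) (coarse (scale k) v) \<union> cell (scale k) (left k v)"

lemma strip_Suc: "strip k v \<subseteq> strip (Suc k) v"
proof -
  have "cell (scale k) (coarse (scale k) v) \<subseteq> cell (scale (Suc k)) (coarse (scale (Suc k)) v)"
    unfolding scale_Suc by (rule cell_subset_cell_mult) (simp add: cell_def coarse_coarse)
  moreover have "cell (scale k) (left k v) \<subseteq> cell (scale (Suc k)) (coarse (S k) (left k v))"
    unfolding scale_Suc by (rule cell_subset_cell_mult) simp
  ultimately show ?thesis using coarse_left[of k v] by (auto simp: strip_def)
qed

lemma block_in_strip:
  assumes "y \<in> block k v" shows "cell (scale k) y \<subseteq> strip (Suc k) v"
proof -
  have "cell (scale k) y \<subseteq> cell (scale (Suc k)) (coarse (S k) y)"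
    unfolding scale_Suc by (rule cell_subset_cell_mult) simp
  then show ?thesis using assms by (auto simp: strip_def block_def left_def)
qed

lemma strip_mono: "j \<le> k \<Longrightarrow> strip j v \<subseteq> strip k v"
  by (rule lift_Suc_mono_le[where f = "\<lambda>k. strip k v"]) (rule strip_Suc)

lemma strip_in_cell:
  assumes "v \<in> cell (scale (Suc k)) z" "left k v \<in> cell (S k) z"
  shows "strip k v \<subseteq> cell (scale (Suc k)) z"
proof -
  have "coarse (scale k) v \<in> cell (S k) z"
    using assms(1) by (simp add: cell_def coarse_coarse scale_Suc)
  then show ?thesis
    using assms(2) cell_subset_cell_mult[of _ "S k" z "scale k"] by (simp add: strip_def scale_Suc)
qed

text \<open>At level \<open>k\<close> the ladder starts in the cell next to that of \<open>v\<close> and must reach the anchor of the cell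
  of level \<open>k + 1\<close> next to that of \<open>v\<close>. The block is a box that contains both, so the direct route works.\<close>

lemma left_to_anchor_in_block:
  "orthotope (left k v) (anchor (S k) (left (Suc k) v)) \<subseteq> block k v" (is "?O \<subseteq> _")
  "(\<Sum>i\<in>UNIV. \<bar>left k v $ i - anchor (S k) (left (Suc k) v) $ i\<bar>) \<le> int ((CARD('d) + 1) * S k)"
proof -
  let ?s = "int (S k)"
  let ?Z = "coarse (scale k) v" and ?Z' = "coarse (scale (Suc k)) v"
  have Z': "?Z' $ i = ?Z $ i div ?s" for i by (simp add: scale_Suc zdiv_zmult2_eq)
  have bnd: "?s * ?Z' $ i \<le> ?Z $ i \<and> ?Z $ i < ?s * ?Z' $ i + ?s" for i
    using div_eq_int_iff[OF S_pos, of "?Z $ i" k "?Z' $ i"] Z' by auto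
  have s5: "?s \<ge> 5" using S_ge[of k] by simp
  have l: "left k v $ i = (if i = m then ?Z $ m - 1 else ?Z $ i)" for i
    by (simp add: left_def axis_apply)
  have a: "anchor (S k) (left (Suc k) v) $ i = (if i = m then ?s * ?Z' $ m - ?s + 2 else ?s * ?Z' $ i + 2)" for i
    by (simp add: left_def axis_apply anchor_def algebra_simps)
  show "?O \<subseteq> block k v"
  proof
    fix w assume w: "w \<in> ?O"
    have off: "w $ i div ?s = ?Z' $ i" if "i \<noteq> m" for i
      unfolding div_eq_int_iff[OF S_pos]
      using w that bnd[of i] s5 unfolding orthotope_def by (auto simp: l a dest!: spec[of _ i])
    have on: "?s * (?Z' $ m - 1) \<le> w $ m" "w $ m < ?Z $ m"
      using w bnd[of m] s5 unfolding orthotope_def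
      by (auto simp: l a algebra_simps dest!: spec[of _ m])
    have "w $ m div ?s = ?Z' $ m \<or> w $ m div ?s = ?Z' $ m - 1"
      unfolding div_eq_int_iff[OF S_pos] using on bnd[of m] by (auto simp: algebra_simps)
    then have "coarse (S k) w = ?Z' \<or> coarse (S k) w = ?Z' - axis m 1"
      using off unfolding vec_eq_iff
      by (metis (no_types, lifting) axis_apply coarse_nth diff_zero vector_minus_component)
    then show "w \<in> block k v" using on by (auto simp: block_def)
  qed
  have "\<bar>left k v $ i - anchor (S k) (left (Suc k) v) $ i\<bar> \<le> ?s + (if i = m then ?s else 0)" for i
    using bnd[of i] s5 by (auto simp: l a)
  then have "(\<Sum>i\<in>UNIV. \<bar>left k v $ i - anchor (S k) (left (Suc k) v) $ i\<bar>)
      \<le> (\<Sum>i\<in>(UNIV::'d set). ?s + (if i = m then ?s else 0))" by (intro sum_mono)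
  then show "(\<Sum>i\<in>UNIV. \<bar>left k v $ i - anchor (S k) (left (Suc k) v) $ i\<bar>) \<le> int ((CARD('d) + 1) * S k)"
    by (simp add: sum.distrib algebra_simps)
qed

text \<open>Climbing from level \<open>j\<close> to level \<open>j + 1\<close> costs at most \<open>(d + 1) * S j\<close> moves of level \<open>j\<close>, each of
  length \<open>reach j\<close>.\<close>

lemma ladder_links:
  assumes "ladder g k v"
  shows "(v - axis m 1, hub g k (left k v)) \<in> step (strip k v) g ^^ ((CARD('d) + 1) * (\<Sum>j<k. S j * reach j))"
  using assms
proof (induction k)
  case 0
  then show ?case by (simp add: left_def vec_eq_iff)
next
  case (Suc k)
  have good: "good g k y" if "y \<in> block k v" for y
    using Suc.prems that by (simp add: ladder_def)
  have "(left k v, anchor (S k) (left (Suc k) v)) \<in> step (block k v) (good g k) ^^ ((CARD('d) + 1) * S k)"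
    using left_to_anchor_in_block[of k v] good by (intro route) auto
  from link_hubs[OF this]
  have 2: "(hub g k (left k v), hub g k (anchor (S k) (left (Suc k) v)))
      \<in> step (strip (Suc k) v) g ^^ ((CARD('d) + 1) * S k * reach k)"
    by (rule relpow_step_mono) (use block_in_strip in blast)+
  have "anchor (S k) (left (Suc k) v) \<in> block k v"
    using left_to_anchor_in_block(1)[of k v] by (auto simp: orthotope_def)
  then have hub: "hub g (Suc k) (left (Suc k) v) = hub g k (anchor (S k) (left (Suc k) v))"
    using good by (simp add: pick_def)
  have 1: "(v - axis m 1, hub g k (left k v))
      \<in> step (strip (Suc k) v) g ^^ ((CARD('d) + 1) * (\<Sum>j<k. S j * reach j))"
  proof (rule relpow_step_mono)
    show "(v - axis m 1, hub g k (left k v)) \<in> step (strip k v) g ^^ ((CARD('d) + 1) * (\<Sum>j<k. S j * reach j))"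
      using Suc by (simp add: ladder_def)
  qed (use strip_Suc in auto)
  show ?case
    using relpow_step_trans[OF 1 2] unfolding hub by (simp add: algebra_simps)
qed

text \<open>The sum telescopes, as \<open>S j * reach j \<le> reach (j + 1) - reach j\<close>: the whole ladder is not longer
  than its last rungs, up to a constant.\<close>

lemma sum_S_reach: "(\<Sum>j<k. S j * reach j) + 1 \<le> reach k"
proof (induction k)
  case (Suc k)
  have "reach k \<ge> 1" using Suc by simp
  then show ?case using Suc by (simp add: reach_Suc algebra_simps)
qed simp

lemma ladder_to_hub:
  assumes all: "\<And>y. y \<in> cell (S k) z \<Longrightarrow> good g k y"
    and v: "v \<in> cell (scale (Suc k)) z" "left k v \<in> cell (S k) z"
    and ladder: "ladder g k v"
  shows "(v - axis m 1, hub g (Suc k) z) \<in> step (cell (scale (Suc k)) z) g ^^ ((CARD('d) + 1) * reach (Suc k))"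
proof -
  let ?V = "cell (scale (Suc k)) z"
  have sub: "cell (scale k) y \<subseteq> ?V" if "y \<in> cell (S k) z" for y
    using cell_subset_cell_mult[OF that, of "scale k"] by (simp add: scale_Suc)
  have "strip k v \<subseteq> ?V" using v by (rule strip_in_cell)
  then have 1: "(v - axis m 1, hub g k (left k v)) \<in> step ?V g ^^ ((CARD('d) + 1) * (\<Sum>j<k. S j * reach j))"
    by (intro relpow_step_mono[OF ladder_links[OF ladder]]) auto
  have "anchor (S k) z \<in> cell (S k) z" by (rule near_anchor_in_cell[OF S_ge]) auto
  then have r: "(left k v, anchor (S k) z) \<in> step (cell (S k) z) (good g k) ^^ (CARD('d) * S k)"
    by (intro route_in_cell v(2) S_pos all)
  have hub_z: "hub g (Suc k) z = hub g k (anchor (S k) z)"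
    by (rule good_all_cell(2)) (rule all)
  from link_hubs[OF r]
  have 2: "(hub g k (left k v), hub g (Suc k) z) \<in> step ?V g ^^ (CARD('d) * S k * reach k)"
    unfolding hub_z by (rule relpow_step_mono) (use sub in auto)
  have "(CARD('d) + 1) * (\<Sum>j<k. S j * reach j) + CARD('d) * S k * reach k
      \<le> (CARD('d) + 1) * (\<Sum>j<Suc k. S j * reach j)" by (simp add: algebra_simps)
  also have "\<dots> \<le> (CARD('d) + 1) * reach (Suc k)"
    using sum_S_reach[of "Suc k"] by (intro mult_left_mono) auto
  finally show ?thesis by (intro relpow_step_mono[OF relpow_step_trans[OF 1 2]]) auto
qed

subsection \<open>An infinite cluster\<close>

text \<open>The cell of level \<open>j\<close> at the origin and the anchor of the next larger cell at the origin are both among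
  the good subcells of that larger cell, so the hubs at the origin of consecutive levels are linked. They are
  pairwise distinct because each lies outside the smaller cell that contains all earlier ones.\<close>

lemma nested_cells_good_cluster:
  assumes good: "\<And>j y. y \<in> cell (S j) 0 \<Longrightarrow> good g j y"
  obtains \<Gamma> where "finite \<Gamma>" "lattice_connected \<Gamma>" "0 \<in> \<Gamma>" "\<And>z. z \<in> \<Gamma> \<Longrightarrow> g z" "card \<Gamma> \<ge> n"
proof -
  have hub_0: "hub g (Suc j) 0 = hub g j (anchor (S j) 0)" for j
    by (rule good_all_cell(2)) (rule good)
  have zero: "0 \<in> cell l 0" for l by (simp add: cell_def vec_eq_iff)
  have g0: "g 0" using good[of 0 0] zero[of "S 0"] by simp
  have "\<exists>N. (0, hub g j 0) \<in> step UNIV g ^^ N" for j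
  proof (induction j)
    case 0
    show ?case by (intro exI[of _ 0]) simp
  next
    case (Suc j)
    then obtain N where N: "(0, hub g j 0) \<in> step UNIV g ^^ N" by blast
    have "anchor (S j) 0 \<in> cell (S j) 0" by (rule near_anchor_in_cell[OF S_ge]) auto
    then have "(0, anchor (S j) 0) \<in> step (cell (S j) 0) (good g j) ^^ (CARD('d) * S j)"
      by (intro route_in_cell zero S_pos good)
    from link_hubs[OF this]
    have "(hub g j 0, hub g (Suc j) 0) \<in> step UNIV g ^^ (CARD('d) * S j * reach j)"
      unfolding hub_0 by (rule relpow_step_mono) auto
    with N show ?case using relpow_step_trans by blast
  qed
  then obtain N where N: "\<And>j. (0, hub g j 0) \<in> step UNIV g ^^ N j" by metis
  have "\<exists>T. finite T \<and> lattice_connected T \<and> 0 \<in> T \<and> hub g j 0 \<in> T \<and> (\<forall>v\<in>T. g v)" for j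
    by (rule relpow_step_connected_set[OF N[of j]]) (use g0 in auto)
  then obtain T where T: "\<And>j. finite (T j)" "\<And>j. lattice_connected (T j)" "\<And>j. 0 \<in> T j"
    "\<And>j. hub g j 0 \<in> T j" "\<And>j v. v \<in> T j \<Longrightarrow> g v" by metis
  have mono: "cell (scale i) 0 \<subseteq> cell (scale j) (0 :: int ^ 'd)" if "i \<le> j" for i j
    using that
  proof (induction rule: dec_induct)
    case (step n)
    then show ?case using cell_subset_cell_mult[OF zero[of "S n"], of "scale n"]
      unfolding scale_Suc by (meson order_trans)
  qed simp
  have ne: "hub g i 0 \<noteq> hub g j 0" if "i < j" for i j
  proof -
    obtain j' where j: "j = Suc j'" "i \<le> j'" using \<open>i < j\<close> by (cases j) auto
    have "hub g j 0 \<in> cell (scale j') (anchor (S j') 0)"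
      unfolding j(1) hub_0 by (rule hub_in_cell)
    moreover have "anchor (S j') 0 \<noteq> (0 :: int ^ 'd)" by (simp add: anchor_def vec_eq_iff)
    moreover have "hub g i 0 \<in> cell (scale j') 0" using hub_in_cell mono[OF j(2)] by blast
    ultimately show ?thesis by (auto simp: cell_def)
  qed
  then have inj: "inj_on (\<lambda>j. hub g j 0) {..<n}"
    by (intro inj_onI) (metis linorder_neqE_nat)
  let ?G = "insert 0 (\<Union>j<n. T j)"
  have G: "?G = (\<Union>j\<in>{..<n}. T j) \<union> {0}" by simp
  show ?thesis
  proof (rule that[of ?G])
    show "finite ?G" using T(1) by simp
    show "lattice_connected ?G"
    proof (cases "n = 0")
      case False
      have "lattice_connected (\<Union>j\<in>{..<n}. T j)"
        using T by (intro lattice_connected_UN_common[where c = 0]) auto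
      then show ?thesis unfolding G using False T(3)
        by (intro lattice_connected_Un[where c = 0]) auto
    qed simp
    have "n = card ((\<lambda>j. hub g j 0) ` {..<n})" using card_image[OF inj] by simp
    also have "\<dots> \<le> card ?G" using T by (intro card_mono) auto
    finally show "n \<le> card ?G" .
  qed (use T g0 in auto)
qed

end

section \<open>Animals assembled from rich cells\<close>

lemma animal_weight_Un:
  assumes "finite A" "finite T"
  shows "animal_weight x (A \<union> T) = animal_weight x A + (\<Sum>v\<in>T - A. x v)"
  using sum.union_disjoint[of A "T - A" x] assms by (simp add: animal_weight_def)

lemma animal_weight_Un_ge:
  assumes "finite A" "finite T" "\<And>v. v \<in> T \<Longrightarrow> - K \<le> x v" "K \<ge> 0"
  shows "animal_weight x (A \<union> T) \<ge> animal_weight x A - K * real (card T)"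
proof -
  have "animal_weight x (A \<union> T) = animal_weight x A + (\<Sum>v\<in>T - A. x v)"
    using assms(1,2) by (rule animal_weight_Un)
  moreover have "(\<Sum>v\<in>T - A. x v) \<ge> (\<Sum>v\<in>T - A. - K)" using assms(3) by (intro sum_mono) auto
  moreover have "real (card (T - A)) \<le> real (card T)" using assms(2) by (simp add: card_mono)
  then have "K * real (card (T - A)) \<le> K * real (card T)" using assms(4) by (intro mult_left_mono)
  ultimately show ?thesis by (simp add: mult.commute)
qed

lemma animal_weight_Un_ge_abs:
  assumes "finite A" "finite T"
  shows "animal_weight x (A \<union> T) \<ge> animal_weight x A - (\<Sum>v\<in>T. \<bar>x v\<bar>)"
proof -
  have "animal_weight x (A \<union> T) = animal_weight x A + (\<Sum>v\<in>T - A. x v)"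
    using assms(1,2) by (rule animal_weight_Un)
  moreover have "\<bar>\<Sum>v\<in>T - A. x v\<bar> \<le> (\<Sum>v\<in>T - A. \<bar>x v\<bar>)" by (rule sum_abs)
  moreover have "(\<Sum>v\<in>T - A. \<bar>x v\<bar>) \<le> (\<Sum>v\<in>T. \<bar>x v\<bar>)" using assms(2) by (intro sum_mono2) auto
  ultimately show ?thesis by linarith
qed

lemma lattice_connected_cell:
  assumes "l > 0" shows "lattice_connected (cell l z)"
  unfolding lattice_connected_def
proof (intro ballI)
  fix u v assume uv: "u \<in> cell l z" "v \<in> cell l z"
  obtain T where T: "lattice_connected T" "u \<in> T" "v \<in> T" "T \<subseteq> cell l z"
    by (rule relpow_step_connected_set[OF route_in_cell[OF uv assms, of "\<lambda>_. True"]]) (use uv in auto)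
  then have "(u, v) \<in> {(a, b). a \<in> T \<and> b \<in> T \<and> nearest_neighbour a b}\<^sup>*"
    by (simp add: lattice_connected_def)
  then show "(u, v) \<in> {(a, b). a \<in> cell l z \<and> b \<in> cell l z \<and> nearest_neighbour a b}\<^sup>*"
    by (rule rtrancl_mono[THEN subsetD, rotated]) (use T(4) in auto)
qed

context hierarchy
begin

text \<open>The sites from which a ladder of height \<open>k\<close> stays inside the cell. This keeps the events of
  different cells independent.\<close>

definition inner :: "nat \<Rightarrow> int ^ 'd \<Rightarrow> (int ^ 'd) set" where
  "inner k z = {v \<in> cell (scale (Suc k)) z. left k v \<in> cell (S k) z}"

text \<open>An animal of weight at least \<open>t\<close> with a site from which it can be attached to the network.\<close>

definition laddered :: "real \<Rightarrow> real \<Rightarrow> nat \<Rightarrow> (int ^ 'd) set \<Rightarrow> (int ^ 'd \<Rightarrow> real) \<Rightarrow> bool" where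
  "laddered K t k V x \<longleftrightarrow> (\<exists>v\<in>V. ladder (\<lambda>v. - K \<le> x v) k v \<and>
     (\<exists>\<xi>. lattice_animal \<xi> \<and> \<xi> \<subseteq> V \<and> v \<in> \<xi> \<and> animal_weight x \<xi> \<ge> t))"

lemma laddered_mono: "V \<subseteq> W \<Longrightarrow> laddered K t k V x \<Longrightarrow> laddered K t k W x"
  unfolding laddered_def by (meson order_trans subsetD)

definition rich :: "real \<Rightarrow> real \<Rightarrow> nat \<Rightarrow> (int ^ 'd \<Rightarrow> real) \<Rightarrow> int ^ 'd \<Rightarrow> bool" where
  "rich K t k x z \<longleftrightarrow>
     (\<forall>y\<in>cell (S k) z. good (\<lambda>v. - K \<le> x v) k y) \<and> laddered K t k (inner k z) x"

lemma rich_good: "rich K t k x z \<Longrightarrow> good (\<lambda>v. - K \<le> x v) (Suc k) z"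
  by (rule good_all_cell(1)) (simp add: rich_def)

text \<open>The animal is extended along its ladder to the hub of the cell; every added site costs at
  most \<open>K\<close>.\<close>

lemma rich_animal:
  assumes rich: "rich K t k x z" and K: "K \<ge> 0"
  obtains \<eta> where "lattice_animal \<eta>" "\<eta> \<subseteq> cell (scale (Suc k)) z"
    "hub (\<lambda>v. - K \<le> x v) (Suc k) z \<in> \<eta>"
    "animal_weight x \<eta> \<ge> t - K * real ((CARD('d) + 1) * reach (Suc k) + 1)"
proof -
  let ?g = "\<lambda>v. - K \<le> x v" and ?V = "cell (scale (Suc k)) z"
  let ?n = "(CARD('d) + 1) * reach (Suc k)"
  obtain v \<xi> where v: "v \<in> inner k z" "ladder ?g k v"
    and \<xi>: "lattice_animal \<xi>" "\<xi> \<subseteq> inner k z" "v \<in> \<xi>" "animal_weight x \<xi> \<ge> t"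
    using rich unfolding rich_def laddered_def by blast
  have path: "(v - axis m 1, hub ?g (Suc k) z) \<in> step ?V ?g ^^ ?n"
    by (rule ladder_to_hub) (use rich v in \<open>auto simp: rich_def inner_def\<close>)
  have "?g (hub ?g (Suc k) z)" "hub ?g (Suc k) z \<in> ?V"
    using good_hub[OF rich_good[OF rich]] hub_in_cell by blast+
  with relpow_step_last[OF relpow_step_sym[OF path]]
  have start: "v - axis m 1 \<in> ?V" "?g (v - axis m 1)" by blast+
  obtain T where T: "finite T" "lattice_connected T" "v - axis m 1 \<in> T" "hub ?g (Suc k) z \<in> T"
    "T \<subseteq> ?V" "\<And>w. w \<in> T \<Longrightarrow> ?g w" "card T \<le> ?n + 1"
    using relpow_step_connected_set[OF path start] by metis
  have nn: "nearest_neighbour (v - axis m 1) v"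
    using nearest_neighbour_axis[of "v - axis m 1" m] by simp
  have "lattice_connected ({v - axis m 1, v} \<union> T)"
    using lattice_connected_edge[OF nn] T by (intro lattice_connected_Un[where c = "v - axis m 1"]) auto
  then have "lattice_connected (\<xi> \<union> ({v - axis m 1, v} \<union> T))"
    by (rule lattice_connected_Un[where c = v, rotated]) (use \<xi> in \<open>auto simp: lattice_animal_def\<close>)
  also have "\<xi> \<union> ({v - axis m 1, v} \<union> T) = \<xi> \<union> T" using \<xi>(3) T(3) by auto
  finally have conn: "lattice_connected (\<xi> \<union> T)" .
  show ?thesis
  proof (rule that[of "\<xi> \<union> T"])
    show "lattice_animal (\<xi> \<union> T)" using conn \<xi> T by (auto simp: lattice_animal_def)
    show "\<xi> \<union> T \<subseteq> ?V" using \<xi>(2) T(5) by (auto simp: inner_def)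
    show "hub ?g (Suc k) z \<in> \<xi> \<union> T" using T(4) by simp
    have "animal_weight x (\<xi> \<union> T) \<ge> animal_weight x \<xi> - K * real (card T)"
      using \<xi> T K by (intro animal_weight_Un_ge) (auto simp: lattice_animal_def)
    moreover have "K * real (card T) \<le> K * real (?n + 1)"
      using T(7) K by (intro mult_left_mono) (simp_all only: of_nat_le_iff)
    ultimately show "animal_weight x (\<xi> \<union> T) \<ge> t - K * real (?n + 1)" using \<xi>(4) by linarith
  qed
qed

text \<open>A bound for the number of joining sites per rich cell: those of the ladder, and those of the paths to
  the hubs of the \<open>2 * d\<close> neighbouring cells.\<close>

definition link_cost :: "nat \<Rightarrow> nat" where
  "link_cost k = (CARD('d) + 1) * reach (Suc k) + 1 + 2 * CARD('d) * (reach (Suc k) + 1)"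

text \<open>The animals of the rich cells of \<open>\<Gamma>\<close> are disjoint, being in different cells, and are joined along hub-to-hub
  paths. Adding the whole cell of the origin puts the origin into the union, at a cost that does not depend on
  \<open>\<Gamma>\<close>.\<close>

lemma rich_cluster_animal:
  assumes K: "K \<ge> 0"
    and \<Gamma>: "finite \<Gamma>" "lattice_connected \<Gamma>" "0 \<in> \<Gamma>"
    and rich: "\<And>z. z \<in> \<Gamma> \<Longrightarrow> rich K t k x z"
  obtains \<Xi> where "lattice_animal \<Xi>" "0 \<in> \<Xi>" "card \<Gamma> \<le> card \<Xi>"
    "card \<Xi> \<le> scale (Suc k) ^ CARD('d) * card \<Gamma>"
    "animal_weight x \<Xi> \<ge> real (card \<Gamma>) * (t - K * real (link_cost k))
       - (\<Sum>v\<in>cell (scale (Suc k)) 0. \<bar>x v\<bar>)"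
proof -
  let ?g = "\<lambda>v. - K \<le> x v" and ?C = "cell (scale (Suc k))"
  let ?hub = "hub ?g (Suc k)"
  have "\<exists>\<eta>. lattice_animal \<eta> \<and> \<eta> \<subseteq> ?C z \<and> ?hub z \<in> \<eta>
      \<and> animal_weight x \<eta> \<ge> t - K * real ((CARD('d) + 1) * reach (Suc k) + 1)" if "z \<in> \<Gamma>" for z
    using rich_animal[OF rich[OF that] K] by metis
  then obtain \<eta> where \<eta>: "\<And>z. z \<in> \<Gamma> \<Longrightarrow> lattice_animal (\<eta> z)" "\<And>z. z \<in> \<Gamma> \<Longrightarrow> \<eta> z \<subseteq> ?C z"
    "\<And>z. z \<in> \<Gamma> \<Longrightarrow> ?hub z \<in> \<eta> z"
    "\<And>z. z \<in> \<Gamma> \<Longrightarrow> animal_weight x (\<eta> z) \<ge> t - K * real ((CARD('d) + 1) * reach (Suc k) + 1)"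
    by metis
  have "\<exists>T. finite T \<and> lattice_connected T \<and> ?hub z \<in> T \<and> ?hub z' \<in> T \<and> T \<subseteq> ?C z \<union> ?C z'
      \<and> (\<forall>v\<in>T. ?g v) \<and> card T \<le> reach (Suc k) + 1"
    if "z \<in> \<Gamma>" "z' \<in> \<Gamma>" "nearest_neighbour z z'" for z z'
  proof -
    have good: "good ?g (Suc k) z" "good ?g (Suc k) z'" using rich that rich_good by blast+
    then have "(z, z') \<in> step {z, z'} (good ?g (Suc k)) ^^ 1"
      using that by (auto simp: step_def)
    from link_hubs[OF this]
    have "(?hub z, ?hub z') \<in> step (?C z \<union> ?C z') ?g ^^ reach (Suc k)" by simp
    from relpow_step_connected_set[OF this] good_hub[OF good(1)] hub_in_cell[of ?g "Suc k" z]
    show ?thesis by (metis UnI1)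
  qed
  then obtain P where P: "\<And>z z'. \<lbrakk>z \<in> \<Gamma>; z' \<in> \<Gamma>; nearest_neighbour z z'\<rbrakk> \<Longrightarrow>
      finite (P z z') \<and> lattice_connected (P z z') \<and> ?hub z \<in> P z z' \<and> ?hub z' \<in> P z z'
      \<and> P z z' \<subseteq> ?C z \<union> ?C z' \<and> (\<forall>v\<in>P z z'. ?g v) \<and> card (P z z') \<le> reach (Suc k) + 1"
    by metis
  define nb where "nb z = {z' \<in> \<Gamma>. nearest_neighbour z z'}" for z
  have nb: "finite (nb z)" "card (nb z) \<le> 2 * CARD('d)" for z
  proof -
    have sub: "nb z \<subseteq> {z'. nearest_neighbour z z'}" by (auto simp: nb_def)
    show "finite (nb z)" using finite_subset[OF sub] card_nearest_neighbours(1) by blast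
    show "card (nb z) \<le> 2 * CARD('d)"
      using card_mono[OF card_nearest_neighbours(1) sub] card_nearest_neighbours(2)[of z] by linarith
  qed
  define Q where "Q z = (\<Union>z'\<in>nb z. P z z')" for z
  define A where "A z = \<eta> z \<union> Q z" for z
  have finQ: "finite (Q z)" if "z \<in> \<Gamma>" for z using nb P that by (auto simp: Q_def nb_def)
  have Aconn: "lattice_connected (A z)" if z: "z \<in> \<Gamma>" for z
  proof -
    have "A z = (\<Union>B \<in> insert (\<eta> z) (P z ` nb z). B)" by (auto simp: A_def Q_def)
    also have "lattice_connected \<dots>"
    proof (rule lattice_connected_UN_common[where c = "?hub z"])
      show "lattice_connected B" "?hub z \<in> B" if "B \<in> insert (\<eta> z) (P z ` nb z)" for B
        using that P[OF z] \<eta>[OF z] by (auto simp: nb_def lattice_animal_def)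
    qed
    finally show ?thesis .
  qed
  have Ameet: "A z \<inter> A z' \<noteq> {}" if "z \<in> \<Gamma>" "z' \<in> \<Gamma>" "nearest_neighbour z z'" for z z'
  proof -
    have "?hub z' \<in> A z" using P[OF that] that by (auto simp: A_def Q_def nb_def)
    moreover have "?hub z' \<in> A z'" using \<eta>(3)[OF that(2)] by (simp add: A_def)
    ultimately show ?thesis by blast
  qed
  define H where "H = (\<Union>z\<in>\<Gamma>. \<eta> z)"
  define Y where "Y = (\<Union>z\<in>\<Gamma>. Q z)"
  define \<Xi> where "\<Xi> = (H \<union> Y) \<union> ?C 0"
  have HY: "H \<union> Y = (\<Union>z\<in>\<Gamma>. A z)" by (auto simp: H_def Y_def A_def)
  have conn: "lattice_connected (H \<union> Y)"
    unfolding HY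
    by (rule lattice_connected_UN[where r = nearest_neighbour])
      (use \<Gamma>(2) Aconn Ameet in \<open>auto simp: lattice_connected_def\<close>)
  have fin: "finite H" "finite Y" "finite (?C z)" for z
    using \<Gamma> \<eta> finQ by (auto simp: H_def Y_def lattice_animal_def finite_cell)
  have hub0: "?hub 0 \<in> H" "?hub 0 \<in> ?C 0"
    using \<eta>(3)[OF \<Gamma>(3)] \<Gamma>(3) hub_in_cell[of ?g "Suc k" 0] unfolding H_def by blast+
  have sub: "\<Xi> \<subseteq> (\<Union>z\<in>\<Gamma>. ?C z)"
  proof -
    have "H \<subseteq> (\<Union>z\<in>\<Gamma>. ?C z)" using \<eta>(2) by (fastforce simp: H_def)
    moreover have "P z z' \<subseteq> (\<Union>z\<in>\<Gamma>. ?C z)" if "z \<in> \<Gamma>" "z' \<in> nb z" for z z'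
      using P[of z z'] that unfolding nb_def by blast
    then have "Y \<subseteq> (\<Union>z\<in>\<Gamma>. ?C z)" unfolding Y_def Q_def by blast
    ultimately show ?thesis using \<Gamma>(3) by (auto simp: \<Xi>_def)
  qed
  have disj: "\<eta> z \<inter> \<eta> z' = {}" if "z \<in> \<Gamma>" "z' \<in> \<Gamma>" "z \<noteq> z'" for z z'
    using \<eta>(2)[OF that(1)] \<eta>(2)[OF that(2)] cell_disjoint[OF that(3), of "scale (Suc k)"] by blast
  have wH: "animal_weight x H = (\<Sum>z\<in>\<Gamma>. animal_weight x (\<eta> z))"
    unfolding animal_weight_def H_def
    by (rule sum.UNION_disjoint) (use \<Gamma> \<eta> disj in \<open>auto simp: lattice_animal_def\<close>)
  have cH: "card H = (\<Sum>z\<in>\<Gamma>. card (\<eta> z))"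
    unfolding H_def by (rule card_UN_disjoint) (use \<Gamma> \<eta> disj in \<open>auto simp: lattice_animal_def\<close>)
  have cY: "card Y \<le> card \<Gamma> * (2 * CARD('d) * (reach (Suc k) + 1))"
  proof -
    have "card (Q z) \<le> 2 * CARD('d) * (reach (Suc k) + 1)" if z: "z \<in> \<Gamma>" for z
    proof -
      have "card (Q z) \<le> (\<Sum>z'\<in>nb z. card (P z z'))" unfolding Q_def by (rule card_UN_le[OF nb(1)])
      also have "\<dots> \<le> (\<Sum>z'\<in>nb z. reach (Suc k) + 1)"
        using P[OF z] by (intro sum_mono) (auto simp: nb_def)
      also have "\<dots> = card (nb z) * (reach (Suc k) + 1)" by simp
      also have "\<dots> \<le> 2 * CARD('d) * (reach (Suc k) + 1)" using nb(2) by (intro mult_right_mono) auto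
      finally show ?thesis .
    qed
    then have "(\<Sum>z\<in>\<Gamma>. card (Q z)) \<le> (\<Sum>z\<in>\<Gamma>. 2 * CARD('d) * (reach (Suc k) + 1))"
      by (intro sum_mono)
    moreover have "card Y \<le> (\<Sum>z\<in>\<Gamma>. card (Q z))" unfolding Y_def by (rule card_UN_le[OF \<Gamma>(1)])
    ultimately show ?thesis by simp
  qed
  have Yg: "- K \<le> x v" if "v \<in> Y" for v
    using that P by (auto simp: Y_def Q_def nb_def)
  show ?thesis
  proof (rule that[of \<Xi>])
    have "lattice_connected \<Xi>" unfolding \<Xi>_def
      by (rule lattice_connected_Un[where c = "?hub 0"])
        (use conn hub0 in \<open>auto intro!: lattice_connected_cell\<close>)
    then show "lattice_animal \<Xi>" using fin hub0 by (auto simp: lattice_animal_def \<Xi>_def)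
    show "0 \<in> \<Xi>" by (simp add: \<Xi>_def cell_def vec_eq_iff)
    have "(\<Sum>z\<in>\<Gamma>. 1) \<le> (\<Sum>z\<in>\<Gamma>. card (\<eta> z))"
      using \<eta>(1) by (intro sum_mono) (auto simp: lattice_animal_def Suc_le_eq card_gt_0_iff)
    then have "card \<Gamma> \<le> card H" using cH by simp
    also have "\<dots> \<le> card \<Xi>" using fin by (intro card_mono) (auto simp: \<Xi>_def)
    finally show "card \<Gamma> \<le> card \<Xi>" .
    have "card \<Xi> \<le> card (\<Union>z\<in>\<Gamma>. ?C z)" using sub fin \<Gamma> by (intro card_mono) auto
    also have "\<dots> \<le> (\<Sum>z\<in>\<Gamma>. card (?C z))" by (rule card_UN_le[OF \<Gamma>(1)])
    also have "\<dots> = scale (Suc k) ^ CARD('d) * card \<Gamma>" by (simp add: card_cell)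
    finally show "card \<Xi> \<le> scale (Suc k) ^ CARD('d) * card \<Gamma>" .
    have "animal_weight x \<Xi> \<ge> animal_weight x (H \<union> Y) - (\<Sum>v\<in>?C 0. \<bar>x v\<bar>)"
      unfolding \<Xi>_def using fin by (intro animal_weight_Un_ge_abs) auto
    moreover have "animal_weight x (H \<union> Y) \<ge> animal_weight x H - K * real (card Y)"
      using fin Yg K by (intro animal_weight_Un_ge) auto
    moreover have "K * real (card Y) \<le> K * real (card \<Gamma> * (2 * CARD('d) * (reach (Suc k) + 1)))"
      using cY K by (intro mult_left_mono) (simp_all only: of_nat_le_iff)
    moreover have "animal_weight x H \<ge> (\<Sum>z\<in>\<Gamma>. t - K * real ((CARD('d) + 1) * reach (Suc k) + 1))"
      unfolding wH using \<eta>(4) by (intro sum_mono)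
    ultimately have "animal_weight x \<Xi> \<ge> (\<Sum>z\<in>\<Gamma>. t - K * real ((CARD('d) + 1) * reach (Suc k) + 1))
        - K * real (card \<Gamma> * (2 * CARD('d) * (reach (Suc k) + 1))) - (\<Sum>v\<in>?C 0. \<bar>x v\<bar>)"
      by linarith
    then show "animal_weight x \<Xi> \<ge> real (card \<Gamma>) * (t - K * real (link_cost k)) - (\<Sum>v\<in>?C 0. \<bar>x v\<bar>)"
      by (simp add: link_cost_def algebra_simps)
  qed
qed

end

text \<open>A discrete intermediate value theorem, since a coordinate changes by at most one along an
  edge.\<close>

lemma connected_coordinate_range:
  assumes "lattice_connected \<xi>" "u \<in> \<xi>" "v \<in> \<xi>"
  shows "{min (u $ i) (v $ i)..max (u $ i) (v $ i)} \<subseteq> (\<lambda>w. w $ i) ` \<xi>"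
proof -
  have "(u, v) \<in> {(a, b). a \<in> \<xi> \<and> b \<in> \<xi> \<and> nearest_neighbour a b}\<^sup>*"
    using assms by (auto simp: lattice_connected_def)
  then show ?thesis
  proof (induction rule: rtrancl_induct)
    case base
    then show ?case using assms(2) by auto
  next
    case (step y z)
    then have "\<bar>y $ i - z $ i\<bar> \<le> 1"
      by (auto elim!: nearest_neighbour_cases simp: axis_apply)
    then have "{min (u $ i) (z $ i)..max (u $ i) (z $ i)}
        \<subseteq> insert (z $ i) {min (u $ i) (y $ i)..max (u $ i) (y $ i)}"
      by auto
    then show ?case using step by blast
  qed
qed

lemma animal_in_cube:
  fixes \<xi> :: "(int ^ 'd::finite) set"
  assumes "lattice_animal \<xi>" "0 \<in> \<xi>" "v \<in> \<xi>"
  shows "- int (card \<xi>) \<le> v $ i \<and> v $ i < int (card \<xi>)"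
proof -
  have "card {min ((0 :: int ^ 'd) $ i) (v $ i)..max ((0 :: int ^ 'd) $ i) (v $ i)} \<le> card ((\<lambda>w. w $ i) ` \<xi>)"
    using assms by (intro card_mono connected_coordinate_range) (auto simp: lattice_animal_def)
  also have "\<dots> \<le> card \<xi>" using assms by (intro card_image_le) (auto simp: lattice_animal_def)
  finally show ?thesis by auto
qed

lemma finite_animals_of_size:
  "finite {\<xi> :: (int ^ 'd::finite) set. lattice_animal \<xi> \<and> card \<xi> = n \<and> 0 \<in> \<xi>}"
proof (rule finite_subset)
  show "{\<xi> :: (int ^ 'd) set. lattice_animal \<xi> \<and> card \<xi> = n \<and> 0 \<in> \<xi>}
      \<subseteq> Pow {v. \<forall>i. - int n \<le> v $ i \<and> v $ i < int n}"
    using animal_in_cube by blast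
qed (simp add: finite_card_orthotope_product)

lemma max_weight_size_ge:
  assumes "lattice_animal \<xi>" "0 \<in> \<xi>"
  shows "max_weight_size x (card \<xi>) \<ge> animal_weight x \<xi>"
  unfolding max_weight_size_def using assms finite_animals_of_size[of "card \<xi>"]
  by (intro Max_ge) auto

text \<open>Along growing clusters the weight per site stays above \<open>1 / (2 * R)\<close>, where \<open>R\<close> is the number of
  sites of a cell.\<close>

lemma (in hierarchy) rich_clusters_positive_growth:
  assumes K: "K \<ge> 0" and t: "t \<ge> K * real (link_cost k) + 1"
    and rich: "\<And>j y. y \<in> cell (S j) 0 \<Longrightarrow> good (rich K t k x) j y"
  shows "\<not> (\<lambda>n. max_weight_size x n / real n) \<longlonglongrightarrow> 0"
proof
  assume lim: "(\<lambda>n. max_weight_size x n / real n) \<longlonglongrightarrow> 0"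
  define R where "R = real (scale (Suc k) ^ CARD('d))"
  define W where "W = (\<Sum>v\<in>cell (scale (Suc k)) 0. \<bar>x v\<bar>)"
  have R: "R > 0" by (simp add: R_def)
  have W: "W \<ge> 0" by (auto simp: W_def intro!: sum_nonneg)
  obtain n0 where n0: "\<And>n. n \<ge> n0 \<Longrightarrow> max_weight_size x n / real n < 1 / (2 * R)"
    using order_tendstoD(2)[OF lim, of "1 / (2 * R)"] R by (auto simp: eventually_sequentially)
  obtain \<Gamma> where \<Gamma>: "finite \<Gamma>" "lattice_connected \<Gamma>" "0 \<in> \<Gamma>" "\<And>z. z \<in> \<Gamma> \<Longrightarrow> rich K t k x z"
    "card \<Gamma> \<ge> Suc (max n0 (nat \<lceil>2 * W\<rceil>))"
    using nested_cells_good_cluster[of "rich K t k x"] rich by metis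
  obtain \<Xi> where \<Xi>: "lattice_animal \<Xi>" "0 \<in> \<Xi>" "card \<Gamma> \<le> card \<Xi>"
    "card \<Xi> \<le> scale (Suc k) ^ CARD('d) * card \<Gamma>"
    "animal_weight x \<Xi> \<ge> real (card \<Gamma>) * (t - K * real (link_cost k)) - W"
    using rich_cluster_animal[OF K \<Gamma>(1-4)] unfolding W_def by metis
  have "real (card \<Gamma>) \<ge> 2 * W" using \<Gamma>(5) by linarith
  moreover have "real (card \<Gamma>) * (t - K * real (link_cost k)) \<ge> real (card \<Gamma>) * 1"
    using t by (intro mult_left_mono) auto
  ultimately have "animal_weight x \<Xi> \<ge> real (card \<Gamma>) / 2" using \<Xi>(5) by linarith
  moreover have "real (card \<Xi>) \<le> R * real (card \<Gamma>)"
    using \<Xi>(4) unfolding R_def by (metis of_nat_le_iff of_nat_mult)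
  moreover have "2 * R * (real (card \<Gamma>) / 2) \<le> 2 * R * max_weight_size x (card \<Xi>)"
    if "real (card \<Gamma>) / 2 \<le> animal_weight x \<Xi>"
    using max_weight_size_ge[OF \<Xi>(1,2), of x] R that by (intro mult_left_mono) auto
  ultimately have "2 * R * max_weight_size x (card \<Xi>) \<ge> real (card \<Xi>)" by simp
  moreover have "card \<Xi> > 0" "card \<Xi> \<ge> n0" using \<Xi>(3) \<Gamma>(5) by auto
  ultimately show False using n0[of "card \<Xi>"] R by (simp add: field_simps)
qed

section \<open>Events of an i.i.d. field\<close>

abbreviation fields :: "(int ^ 'd::finite \<Rightarrow> real) measure" where
  "fields \<equiv> \<Pi>\<^sub>M v\<in>UNIV. borel"

text \<open>A measurable property of the field that is determined by the sites in \<open>V\<close>. Properties of the field, rather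
  than events of the probability space, are the objects that can be shifted and compared.\<close>

definition observable :: "(int ^ 'd::finite) set \<Rightarrow> ((int ^ 'd \<Rightarrow> real) \<Rightarrow> bool) \<Rightarrow> bool" where
  "observable V P \<longleftrightarrow> Measurable.pred fields P \<and> (\<forall>x y. (\<forall>v\<in>V. x v = y v) \<longrightarrow> P x = P y)"

lemma space_fields [simp]: "space fields = UNIV"
  by (simp add: space_PiM)

lemma observable_pred: "observable V P \<Longrightarrow> Measurable.pred fields P"
  by (simp add: observable_def)

lemma observable_cong: "observable V P \<Longrightarrow> (\<And>v. v \<in> V \<Longrightarrow> x v = y v) \<Longrightarrow> P x = P y"
  unfolding observable_def by blast

lemma observableI:
  assumes "Measurable.pred fields P" "\<And>x y. (\<And>v. v \<in> V \<Longrightarrow> x v = y v) \<Longrightarrow> P x \<Longrightarrow> P y"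
  shows "observable V P"
  unfolding observable_def using assms by metis

lemma observable_mono: "observable V P \<Longrightarrow> V \<subseteq> W \<Longrightarrow> observable W P"
  unfolding observable_def by (meson subsetD)

lemma observable_const: "observable V (\<lambda>_. b)"
  by (simp add: observable_def)

lemma observable_not:
  assumes "observable V P" shows "observable V (\<lambda>x. \<not> P x)"
proof (rule observableI)
  show "Measurable.pred fields (\<lambda>x. \<not> P x)" by (intro pred_intros_logic observable_pred[OF assms])
  show "\<not> P y" if "\<And>v. v \<in> V \<Longrightarrow> x v = y v" "\<not> P x" for x y
    using observable_cong[OF assms that(1)] that(2) by simp
qed

lemma observable_conj:
  assumes "observable V P" "observable V Q" shows "observable V (\<lambda>x. P x \<and> Q x)"
proof (rule observableI)
  show "Measurable.pred fields (\<lambda>x. P x \<and> Q x)"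
    by (intro pred_intros_logic assms[THEN observable_pred])
  show "P y \<and> Q y" if "\<And>v. v \<in> V \<Longrightarrow> x v = y v" "P x \<and> Q x" for x y
    using observable_cong[OF assms(1) that(1)] observable_cong[OF assms(2) that(1)] that(2) by simp
qed

lemma observable_ball:
  assumes "finite I" "\<And>i. i \<in> I \<Longrightarrow> observable V (P i)"
  shows "observable V (\<lambda>x. \<forall>i\<in>I. P i x)"
proof (rule observableI)
  show "Measurable.pred fields (\<lambda>x. \<forall>i\<in>I. P i x)"
    using assms observable_pred by (intro pred_intros_finite) blast+
  show "\<forall>i\<in>I. P i y" if "\<And>v. v \<in> V \<Longrightarrow> x v = y v" "\<forall>i\<in>I. P i x" for x y
    using observable_cong[OF assms(2) that(1)] that(2) by simp
qed

lemma observable_bex: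
  assumes "finite I" "\<And>i. i \<in> I \<Longrightarrow> observable V (P i)"
  shows "observable V (\<lambda>x. \<exists>i\<in>I. P i x)"
proof -
  have "observable V (\<lambda>x. \<not> (\<forall>i\<in>I. \<not> P i x))"
    using assms by (intro observable_not observable_ball)
  then show ?thesis by simp
qed

lemma observable_all_nat:
  assumes "\<And>i::nat. observable V (P i)" shows "observable V (\<lambda>x. \<forall>i. P i x)"
proof (rule observableI)
  show "Measurable.pred fields (\<lambda>x. \<forall>i. P i x)"
    using assms observable_pred by (intro pred_intros_countable) blast
  show "\<forall>i. P i y" if "\<And>v. v \<in> V \<Longrightarrow> x v = y v" "\<forall>i. P i x" for x y
    using observable_cong[OF assms that(1)] that(2) by simp
qed

lemma observable_site_ge: "observable {v} (\<lambda>x. c \<le> x v)"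
proof (rule observableI)
  have [measurable]: "(\<lambda>x. x v) \<in> borel_measurable fields" by (rule measurable_component_singleton) simp
  show "Measurable.pred fields (\<lambda>x. c \<le> x v)" by measurable
qed auto

lemma observable_weight_ge: "observable \<xi> (\<lambda>x. c \<le> animal_weight x \<xi>)"
proof (rule observableI)
  have [measurable]: "(\<lambda>x. x v) \<in> borel_measurable fields" for v
    by (rule measurable_component_singleton) simp
  show "Measurable.pred fields (\<lambda>x. c \<le> animal_weight x \<xi>)" unfolding animal_weight_def by measurable
qed (simp add: animal_weight_def cong: sum.cong)

definition heavy :: "real \<Rightarrow> (int ^ 'd::finite) set \<Rightarrow> (int ^ 'd \<Rightarrow> real) \<Rightarrow> bool" where
  "heavy t V x \<longleftrightarrow> (\<exists>\<xi>. lattice_animal \<xi> \<and> \<xi> \<subseteq> V \<and> animal_weight x \<xi> \<ge> t)"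

lemma heavy_mono: "V \<subseteq> W \<Longrightarrow> heavy t V x \<Longrightarrow> heavy t W x"
  by (auto simp: heavy_def)

lemma observable_animal_bex:
  assumes "finite V"
  shows "observable V (\<lambda>x. \<exists>\<xi>. lattice_animal \<xi> \<and> \<xi> \<subseteq> V \<and> Q \<xi> \<and> animal_weight x \<xi> \<ge> t)"
proof -
  have "observable V (\<lambda>x. \<exists>\<xi>\<in>{\<xi> \<in> Pow V. lattice_animal \<xi> \<and> Q \<xi>}. animal_weight x \<xi> \<ge> t)"
    using assms by (intro observable_bex) (auto intro: observable_mono[OF observable_weight_ge])
  also have "(\<lambda>x. \<exists>\<xi>\<in>{\<xi> \<in> Pow V. lattice_animal \<xi> \<and> Q \<xi>}. animal_weight x \<xi> \<ge> t) =
      (\<lambda>x. \<exists>\<xi>. lattice_animal \<xi> \<and> \<xi> \<subseteq> V \<and> Q \<xi> \<and> animal_weight x \<xi> \<ge> t)" by auto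
  finally show ?thesis .
qed

lemma observable_heavy: "finite V \<Longrightarrow> observable V (heavy t V)"
  using observable_animal_bex[of V "\<lambda>_. True" t] by (simp add: heavy_def[abs_def])

locale iid_field = prob_space M for M :: "'a measure" +
  fixes X :: "int ^ 'd::finite \<Rightarrow> 'a \<Rightarrow> real" and F :: "real \<Rightarrow> real"
  assumes indep: "indep_vars (\<lambda>_. borel) X UNIV"
    and law: "\<And>v. cdf (distr M borel (X v)) = F"
begin

definition pr :: "((int ^ 'd \<Rightarrow> real) \<Rightarrow> bool) \<Rightarrow> real" where
  "pr P = prob {\<omega> \<in> space M. P (\<lambda>v. X v \<omega>)}"

lemma X_measurable [measurable]: "X v \<in> borel_measurable M"
  using indep by (auto simp: indep_vars_def)

lemma field_measurable [measurable]: "(\<lambda>\<omega> v. X v \<omega>) \<in> measurable M fields"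
  by (rule measurable_PiM_single') auto

lemma event: "Measurable.pred fields P \<Longrightarrow> {\<omega> \<in> space M. P (\<lambda>v. X v \<omega>)} \<in> events"
  using measurable_compose[OF field_measurable, of P "count_space UNIV"] by (simp add: pred_def)

lemma obs_event: "observable V P \<Longrightarrow> {\<omega> \<in> space M. P (\<lambda>v. X v \<omega>)} \<in> events"
  by (intro event observable_pred)

lemma pr_le_1: "pr P \<le> 1" and pr_nonneg: "0 \<le> pr P"
  by (simp_all add: pr_def)

lemma pr_mono:
  assumes "observable V Q" "\<And>x. P x \<Longrightarrow> Q x" shows "pr P \<le> pr Q"
  unfolding pr_def using assms by (intro finite_measure_mono obs_event) auto

lemma pr_not: "observable V P \<Longrightarrow> pr (\<lambda>x. \<not> P x) = 1 - pr P"
  unfolding pr_def by (rule prob_neg[OF obs_event])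

lemma pr_disj_le:
  assumes "observable V P" "observable W Q"
  shows "pr (\<lambda>x. P x \<or> Q x) \<le> pr P + pr Q"
proof -
  have "{\<omega> \<in> space M. P (\<lambda>v. X v \<omega>) \<or> Q (\<lambda>v. X v \<omega>)}
      = {\<omega> \<in> space M. P (\<lambda>v. X v \<omega>)} \<union> {\<omega> \<in> space M. Q (\<lambda>v. X v \<omega>)}" by auto
  then show ?thesis unfolding pr_def
    using assms by (simp only:) (intro measure_Un_le obs_event)
qed

lemma pr_bex_le:
  assumes "finite I" "\<And>i. i \<in> I \<Longrightarrow> observable V (P i)"
  shows "pr (\<lambda>x. \<exists>i\<in>I. P i x) \<le> (\<Sum>i\<in>I. pr (P i))"
proof -
  have "{\<omega> \<in> space M. \<exists>i\<in>I. P i (\<lambda>v. X v \<omega>)} = (\<Union>i\<in>I. {\<omega> \<in> space M. P i (\<lambda>v. X v \<omega>)})" by auto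
  then show ?thesis unfolding pr_def
    using assms obs_event by (simp only:) (intro finite_measure_subadditive_finite, auto)
qed

lemma pr_ex_nat_le:
  assumes "\<And>i::nat. observable V (P i)" "\<And>i. pr (P i) \<le> b i" "b sums B"
  shows "pr (\<lambda>x. \<exists>i. P i x) \<le> B"
proof -
  have eq: "{\<omega> \<in> space M. \<exists>i. P i (\<lambda>v. X v \<omega>)} = (\<Union>i. {\<omega> \<in> space M. P i (\<lambda>v. X v \<omega>)})" by auto
  have sm: "summable (\<lambda>i. pr (P i))"
    by (rule summable_comparison_test_ev[OF _ sums_summable[OF assms(3)]])
      (use assms(2) pr_nonneg in auto)
  have "pr (\<lambda>x. \<exists>i. P i x) \<le> (\<Sum>i. pr (P i))"
    unfolding pr_def eq using assms(1) obs_event sm[unfolded pr_def]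
    by (intro finite_measure_subadditive_countably) auto
  also have "\<dots> \<le> (\<Sum>i. b i)" using assms sm by (intro suminf_le sums_summable[OF assms(3)])
  finally show ?thesis using assms(3) by (simp add: sums_iff)
qed

lemma pr_conj_indep:
  assumes P: "observable V P" and Q: "observable W Q" and disj: "V \<inter> W = {}"
  shows "pr (\<lambda>x. P x \<and> Q x) = pr P * pr Q"
proof -
  let ?pad = "\<lambda>V (y :: int ^ 'd \<Rightarrow> real) v. if v \<in> V then y v else 0"
  have pad: "?pad V \<in> measurable (\<Pi>\<^sub>M v\<in>V. borel) fields" for V
  proof (rule measurable_PiM_single')
    fix v show "(\<lambda>y. if v \<in> V then y v else (0::real)) \<in> borel_measurable (\<Pi>\<^sub>M v\<in>V. borel)"
      by (cases "v \<in> V") (simp_all add: measurable_component_singleton)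
  qed auto
  have set: "{y \<in> space (\<Pi>\<^sub>M v\<in>V. borel). P (?pad V y)} \<in> sets (\<Pi>\<^sub>M v\<in>V. borel)" 
    if "observable V P" for V P
    using measurable_compose[OF pad[of V] observable_pred[OF that]] by (simp add: pred_def)
  have restr: "P (?pad V (\<lambda>v\<in>V. X v \<omega>)) = P (\<lambda>v. X v \<omega>)" if "observable V P" for V P \<omega>
    by (rule observable_cong[OF that]) auto
  have spc: "(\<lambda>v\<in>V. X v \<omega>) \<in> space (\<Pi>\<^sub>M v\<in>V. borel)" for V \<omega> by (auto simp: space_PiM)
  have "indep_var (\<Pi>\<^sub>M v\<in>V. borel) (\<lambda>\<omega>. \<lambda>v\<in>V. X v \<omega>) (\<Pi>\<^sub>M v\<in>W. borel) (\<lambda>\<omega>. \<lambda>v\<in>W. X v \<omega>)"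
    by (rule indep_var_restrict[OF indep disj]) auto
  from indep_varD[OF this set[OF P] set[OF Q]]
  show ?thesis unfolding pr_def
    using spc by (simp add: vimage_def restr[OF P] restr[OF Q] Int_def conj_commute)
qed

lemma pr_ball_indep:
  assumes "finite I" "\<And>i. i \<in> I \<Longrightarrow> observable (V i) (P i)"
    and "\<And>i j. i \<in> I \<Longrightarrow> j \<in> I \<Longrightarrow> i \<noteq> j \<Longrightarrow> V i \<inter> V j = {}"
  shows "pr (\<lambda>x. \<forall>i\<in>I. P i x) = (\<Prod>i\<in>I. pr (P i))"
  using assms
proof (induction I rule: finite_induct)
  case empty
  then show ?case by (simp add: pr_def prob_space)
next
  case (insert i I)
  have "pr (\<lambda>x. \<forall>j\<in>insert i I. P j x) = pr (\<lambda>x. P i x \<and> (\<forall>j\<in>I. P j x))" by simp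
  also have "\<dots> = pr (P i) * pr (\<lambda>x. \<forall>j\<in>I. P j x)"
  proof (rule pr_conj_indep)
    show "observable (V i) (P i)" using insert by auto
    show "observable (\<Union>j\<in>I. V j) (\<lambda>x. \<forall>j\<in>I. P j x)"
      using insert by (intro observable_ball) (auto intro: observable_mono)
    show "V i \<inter> (\<Union>j\<in>I. V j) = {}"
    proof -
      have "V i \<inter> V j = {}" if "j \<in> I" for j using insert.prems(2)[of i j] insert.hyps(2) that by auto
      then show ?thesis by auto
    qed
  qed
  also have "pr (\<lambda>x. \<forall>j\<in>I. P j x) = (\<Prod>j\<in>I. pr (P j))"
    by (rule insert.IH) (use insert.prems in auto)
  finally show ?case using insert.hyps by simp
qed

text \<open>The shifted field is again independent with the same marginals, hence has the same product
  law.\<close>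

lemma pr_shift:
  assumes "Measurable.pred fields P"
  shows "pr (\<lambda>x. P (\<lambda>v. x (v + a))) = pr P"
proof -
  let ?Y = "\<lambda>v. X (v + a)"
  have Y: "indep_vars (\<lambda>_. borel) ?Y UNIV"
  proof -
    have ind: "indep_sets (\<lambda>v. {X v -` A \<inter> space M | A. A \<in> sets borel}) UNIV"
      using indep by (simp add: indep_vars_def2)
    have "indep_sets (\<lambda>v. {X (v + a) -` A \<inter> space M | A. A \<in> sets borel}) UNIV"
    proof (rule indep_setsI)
      fix A J assume J: "J \<noteq> {}" "J \<subseteq> UNIV" "finite J"
        and A: "\<forall>j\<in>J. A j \<in> {X (j + a) -` B \<inter> space M | B. B \<in> sets borel}"
      let ?J = "(\<lambda>v. v + a) ` J" and ?A = "\<lambda>w. A (w - a)"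
      have "prob (\<Inter>j\<in>?J. ?A j) = (\<Prod>j\<in>?J. prob (?A j))"
        by (rule indep_setsD[OF ind]) (use J A in auto)
      moreover have "(\<Inter>j\<in>?J. ?A j) = (\<Inter>j\<in>J. A j)" by auto
      moreover have "(\<Prod>j\<in>?J. prob (?A j)) = (\<Prod>j\<in>J. prob (A j))"
        by (subst prod.reindex) (auto simp: inj_on_def)
      ultimately show "prob (\<Inter>j\<in>J. A j) = (\<Prod>j\<in>J. prob (A j))" by simp
    qed auto
    then show ?thesis by (simp add: indep_vars_def2)
  qed
  have same: "distr M borel (X v) = distr M borel (X w)" for v w
    by (rule cdf_unique) (auto simp: law)
  have "distr M fields (\<lambda>\<omega> v. X v \<omega>) = (\<Pi>\<^sub>M v\<in>UNIV. distr M borel (X v))"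
    using indep_vars_iff_distr_eq_PiM[of UNIV X "\<lambda>_. borel"] indep by (simp add: restrict_UNIV)
  moreover have "distr M fields (\<lambda>\<omega> v. ?Y v \<omega>) = (\<Pi>\<^sub>M v\<in>UNIV. distr M borel (?Y v))"
    using indep_vars_iff_distr_eq_PiM[of UNIV ?Y "\<lambda>_. borel"] Y by (simp add: restrict_UNIV)
  moreover have "(\<Pi>\<^sub>M v\<in>UNIV. distr M borel (?Y v)) = (\<Pi>\<^sub>M v\<in>UNIV. distr M borel (X v))"
    by (rule PiM_cong) (auto intro: same)
  ultimately have eq: "distr M fields (\<lambda>\<omega> v. ?Y v \<omega>) = distr M fields (\<lambda>\<omega> v. X v \<omega>)" by simp
  have Ym: "(\<lambda>\<omega> v. ?Y v \<omega>) \<in> measurable M fields" by (rule measurable_PiM_single') auto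
  have S: "{x. P x} \<in> sets fields" using assms by (simp add: pred_def)
  have "pr P = measure (distr M fields (\<lambda>\<omega> v. X v \<omega>)) {x. P x}"
    unfolding pr_def using S by (subst measure_distr) (auto intro!: arg_cong[where f = prob])
  also have "\<dots> = measure (distr M fields (\<lambda>\<omega> v. ?Y v \<omega>)) {x. P x}" by (simp only: eq)
  also have "\<dots> = pr (\<lambda>x. P (\<lambda>v. x (v + a)))"
    unfolding pr_def using S Ym by (subst measure_distr) (auto intro!: arg_cong[where f = prob])
  finally show ?thesis ..
qed

lemma pr_site_below:
  assumes "e > 0" obtains K where "K \<ge> 0" "\<And>v. pr (\<lambda>x. \<not> - K \<le> x v) \<le> e"
proof -
  interpret D: real_distribution "distr M borel (X 0)" by (rule real_distribution_distr) simp
  have "(F \<longlongrightarrow> 0) at_bot" using D.cdf_lim_at_bot by (simp add: law)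
  from order_tendstoD(2)[OF this assms] obtain B where B: "\<And>b. b \<le> B \<Longrightarrow> F b < e"
    by (auto simp: eventually_at_bot_linorder)
  define K where "K = max 0 (- B)"
  show ?thesis
  proof (rule that[of K])
    show "K \<ge> 0" by (simp add: K_def)
    fix v
    have "pr (\<lambda>x. \<not> - K \<le> x v) \<le> prob (X v -` {..- K} \<inter> space M)"
      unfolding pr_def by (rule finite_measure_mono) (auto intro!: measurable_sets[OF X_measurable])
    also have "\<dots> = cdf (distr M borel (X v)) (- K)" by (simp add: cdf_def measure_distr)
    also have "\<dots> = F (- K)" by (simp add: law)
    also have "- K \<le> B" by (auto simp: K_def)
    then have "F (- K) \<le> e" using B[of "- K"] by simp
    finally show "pr (\<lambda>x. \<not> - K \<le> x v) \<le> e" .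
  qed
qed

end

lemma lattice_connected_translate:
  fixes a :: "int ^ 'd::finite"
  assumes "lattice_connected \<xi>" shows "lattice_connected ((\<lambda>v. v + a) ` \<xi>)"
  unfolding lattice_connected_def
proof (intro ballI)
  let ?r = "\<lambda>\<xi>. {(u, v). u \<in> \<xi> \<and> v \<in> \<xi> \<and> nearest_neighbour u v}"
  fix u v assume "u \<in> (\<lambda>v. v + a) ` \<xi>" "v \<in> (\<lambda>v. v + a) ` \<xi>"
  then obtain u' v' where uv: "u = u' + a" "v = v' + a" "u' \<in> \<xi>" "v' \<in> \<xi>" by auto
  then have "(u', v') \<in> (?r \<xi>)\<^sup>*" using assms by (auto simp: lattice_connected_def)
  then have "(u' + a, v' + a) \<in> (?r ((\<lambda>v. v + a) ` \<xi>))\<^sup>*"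
  proof (induction rule: rtrancl_induct)
    case (step y z)
    then have "(y + a, z + a) \<in> ?r ((\<lambda>v. v + a) ` \<xi>)" by (auto simp: nearest_neighbour_def)
    then show ?case using step.IH by (rule rtrancl_into_rtrancl[rotated])
  qed simp
  then show "(u, v) \<in> (?r ((\<lambda>v. v + a) ` \<xi>))\<^sup>*" using uv by simp
qed

lemma heavy_translate:
  fixes a :: "int ^ 'd::finite"
  shows "heavy t ((\<lambda>v. v + a) ` V) x \<longleftrightarrow> heavy t V (\<lambda>v. x (v + a))"
proof -
  have one: "heavy t ((\<lambda>v. v + a) ` V) x" if heavy: "heavy t V (\<lambda>v. x (v + a))" for a :: "int ^ 'd" and V x
  proof -
    obtain \<xi> where \<xi>: "lattice_animal \<xi>" "\<xi> \<subseteq> V" "animal_weight (\<lambda>v. x (v + a)) \<xi> \<ge> t"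
      using heavy by (auto simp: heavy_def)
    have "animal_weight x ((\<lambda>v. v + a) ` \<xi>) = animal_weight (\<lambda>v. x (v + a)) \<xi>"
      unfolding animal_weight_def by (subst sum.reindex) (auto simp: inj_on_def)
    then show ?thesis using \<xi> lattice_connected_translate[of \<xi> a]
      unfolding heavy_def lattice_animal_def by (intro exI[of _ "(\<lambda>v. v + a) ` \<xi>"]) auto
  qed
  show ?thesis
  proof
    assume "heavy t ((\<lambda>v. v + a) ` V) x"
    then have "heavy t ((\<lambda>v. v + - a) ` (\<lambda>v. v + a) ` V) (\<lambda>v. x (v + a))"
      using one[of "(\<lambda>v. v + a) ` V" "\<lambda>v. x (v + a)" "- a"] by simp
    then show "heavy t V (\<lambda>v. x (v + a))" by (simp add: image_image)
  qed (rule one)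
qed

lemma (in iid_field) pr_heavy_translate:
  assumes "finite V"
  shows "pr (heavy t ((\<lambda>v. v + a) ` V)) = pr (heavy t V)"
  using pr_shift[OF observable_pred[OF observable_heavy[OF assms]]] by (simp add: heavy_translate[abs_def])

section \<open>Probability estimates along the hierarchy\<close>

text \<open>The ratios \<open>S j\<close> may grow, but slowly enough that squaring the probability of a bad cell outweighs
  the growing number of pairs of subcells.\<close>

locale iid_hierarchy = hierarchy S m + iid_field M X F
  for S :: "nat \<Rightarrow> nat" and m :: "'d::finite" and M :: "'a measure"
    and X :: "int ^ 'd \<Rightarrow> 'a \<Rightarrow> real" and F :: "real \<Rightarrow> real" +
  assumes S_double: "S (Suc j) \<le> 2 * S j"
begin

lemma observable_good:
  assumes "\<And>z. observable (V z) (\<lambda>x. G x z)"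
  shows "observable (\<Union>w\<in>cell (scale j) z. V w) (\<lambda>x. good (G x) j z)"
proof (induction j arbitrary: z)
  case 0
  then show ?case using assms by simp
next
  case (Suc j)
  let ?V = "\<Union>w\<in>cell (scale (Suc j)) z. V w"
  have obs: "observable ?V (\<lambda>x. good (G x) j y)" if "y \<in> cell (S j) z" for y
    by (rule observable_mono[OF Suc]) (use cell_subset_cell_mult[OF that, of "scale j"] in \<open>auto simp: scale_Suc\<close>)
  have "observable ?V (\<lambda>x. \<not> good (G x) j y \<longrightarrow> \<not> good (G x) j y' \<longrightarrow> y = y')"
    if "y \<in> cell (S j) z" "y' \<in> cell (S j) z" for y y'
  proof (cases "y = y'")
    case True
    then show ?thesis by (simp add: observable_const)
  next
    case False
    have "observable ?V (\<lambda>x. \<not> (\<not> good (G x) j y \<and> \<not> good (G x) j y'))"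
      by (intro observable_not observable_conj obs that)
    then show ?thesis using False by (simp add: de_Morgan_conj imp_conv_disj)
  qed
  then have "observable ?V (\<lambda>x. \<forall>y\<in>cell (S j) z. \<forall>y'\<in>cell (S j) z.
      \<not> good (G x) j y \<longrightarrow> \<not> good (G x) j y' \<longrightarrow> y = y')"
    by (intro observable_ball finite_cell S_pos) auto
  then show ?case by (simp add: at_most_one_bad_def)
qed

text \<open>A cell of level \<open>j + 1\<close> has \<open>(S j) ^ (2 * d)\<close> pairs of subcells. Dividing by this number leaves a
  bound that for small \<open>\<rho>\<close> survives squaring and summation over the pairs (\<open>bad_bound_step\<close>).\<close>

definition bad_bound :: "real \<Rightarrow> nat \<Rightarrow> real" where
  "bad_bound \<rho> j = \<rho> * (1 / 2) ^ j / real (S j) ^ (2 * CARD('d))"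

lemma bad_bound_step:
  assumes "0 \<le> \<rho>" "\<rho> \<le> 1 / (16 * 4 ^ CARD('d))"
  shows "real (S j) ^ (2 * CARD('d)) * (bad_bound \<rho> j)\<^sup>2 \<le> bad_bound \<rho> (Suc j)"
proof -
  let ?n = "2 * CARD('d)"
  let ?s = "real (S j) ^ ?n" and ?s' = "real (S (Suc j)) ^ ?n" and ?h = "(1 / 2 :: real) ^ j"
  have s: "?s > 0" "?s' > 0" using S_pos by simp_all
  have "real (S (Suc j)) \<le> 2 * real (S j)" using S_double[of j] by linarith
  then have "?s' \<le> (2 * real (S j)) ^ ?n" by (rule power_mono) simp
  also have "\<dots> = 4 ^ CARD('d) * ?s" by (simp add: power_mult_distrib power_mult)
  finally have s': "?s' \<le> 4 ^ CARD('d) * ?s" .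
  have "\<rho> * 4 ^ CARD('d) \<le> 1 / 16" using assms(2) by (simp add: field_simps)
  moreover have "?h \<le> 1" by (simp add: power_le_one)
  ultimately have "\<rho> * 4 ^ CARD('d) * ?h \<le> 1 / 16 * 1" using assms(1) by (intro mult_mono) auto
  then have "(\<rho> * ?h) * (\<rho> * ?h * 4 ^ CARD('d)) \<le> (\<rho> * ?h) * (1 / 2)"
    using assms(1) by (intro mult_left_mono) (auto simp: ac_simps)
  then have "(\<rho> * ?h) * (\<rho> * ?h * 4 ^ CARD('d)) * ?s \<le> (\<rho> * ?h) * (1 / 2) * ?s"
    using s by (intro mult_right_mono) auto
  then have "(\<rho> * ?h)\<^sup>2 * (4 ^ CARD('d) * ?s) \<le> (\<rho> * ?h * (1 / 2)) * ?s"
    by (simp only: power2_eq_square mult.assoc)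
  moreover have "(\<rho> * ?h)\<^sup>2 * ?s' \<le> (\<rho> * ?h)\<^sup>2 * (4 ^ CARD('d) * ?s)"
    using s' by (intro mult_left_mono) auto
  ultimately have "(\<rho> * ?h)\<^sup>2 * ?s' \<le> (\<rho> * ?h * (1 / 2)) * ?s" by linarith
  then have "(\<rho> * ?h)\<^sup>2 / ?s \<le> (\<rho> * ?h * (1 / 2)) / ?s'"
    using s by (simp add: field_simps)
  then show ?thesis
    using s assms(1) by (simp add: bad_bound_def power_divide power2_eq_square field_simps)
qed

text \<open>A bad cell has two distinct bad subcells, which are independent.\<close>

lemma pr_bad:
  assumes obs: "\<And>z. observable (V z) (\<lambda>x. G x z)" and disj: "\<And>z z'. z \<noteq> z' \<Longrightarrow> V z \<inter> V z' = {}"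
    and \<rho>: "0 \<le> \<rho>" "\<rho> \<le> 1 / (16 * 4 ^ CARD('d))"
    and base: "\<And>z. pr (\<lambda>x. \<not> G x z) \<le> bad_bound \<rho> 0"
  shows "pr (\<lambda>x. \<not> good (G x) j z) \<le> bad_bound \<rho> j"
proof (induction j arbitrary: z)
  case 0
  then show ?case using base by simp
next
  case (Suc j)
  let ?C = "cell (S j) z"
  let ?I = "{p \<in> ?C \<times> ?C. fst p \<noteq> snd p}"
  let ?P = "\<lambda>p x. \<not> good (G x) j (fst p) \<and> \<not> good (G x) j (snd p)"
  let ?V = "\<lambda>z. \<Union>w\<in>cell (scale j) z. V w"
  have fin: "finite (?C \<times> ?C)" by (simp add: finite_cell)
  have og: "observable (?V z) (\<lambda>x. \<not> good (G x) j z)" for z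
    by (intro observable_not observable_good obs)
  have oP: "observable UNIV (?P p)" for p
    by (intro observable_conj observable_mono[OF og]) auto
  have "pr (\<lambda>x. \<not> good (G x) (Suc j) z) \<le> pr (\<lambda>x. \<exists>p\<in>?I. ?P p x)"
  proof (rule pr_mono)
    show "observable UNIV (\<lambda>x. \<exists>p\<in>?I. ?P p x)"
      by (rule observable_bex) (use fin oP in auto)
    show "\<exists>p\<in>?I. ?P p x" if "\<not> good (G x) (Suc j) z" for x
      using that by (auto simp: at_most_one_bad_def)
  qed
  also have "\<dots> \<le> (\<Sum>p\<in>?I. pr (?P p))"
    by (rule pr_bex_le) (use fin oP in auto)
  also have "\<dots> \<le> (\<Sum>p\<in>?I. (bad_bound \<rho> j)\<^sup>2)"
  proof (rule sum_mono)
    fix p assume p: "p \<in> ?I"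
    have "?V (fst p) \<inter> ?V (snd p) = {}"
    proof -
      have "V w \<inter> V w' = {}" if "w \<in> cell (scale j) (fst p)" "w' \<in> cell (scale j) (snd p)" for w w'
      proof (rule disj)
        show "w \<noteq> w'" using that cell_disjoint[of "fst p" "snd p" "scale j"] p by auto
      qed
      then show ?thesis by blast
    qed
    then have "pr (?P p) = pr (\<lambda>x. \<not> good (G x) j (fst p)) * pr (\<lambda>x. \<not> good (G x) j (snd p))"
      by (rule pr_conj_indep[OF og og])
    also have "\<dots> \<le> bad_bound \<rho> j * bad_bound \<rho> j"
      by (intro mult_mono Suc pr_nonneg order_trans[OF pr_nonneg Suc])
    finally show "pr (?P p) \<le> (bad_bound \<rho> j)\<^sup>2" by (simp add: power2_eq_square)
  qed
  also have "\<dots> = real (card ?I) * (bad_bound \<rho> j)\<^sup>2" by simp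
  also have "\<dots> \<le> real (S j) ^ (2 * CARD('d)) * (bad_bound \<rho> j)\<^sup>2"
  proof (rule mult_right_mono)
    have "card ?I \<le> card (?C \<times> ?C)" using fin by (intro card_mono) auto
    also have "\<dots> = S j ^ (2 * CARD('d))"
      by (simp add: card_cartesian_product card_cell power2_eq_square mult_2 power_add)
    finally have "real (card ?I) \<le> real (S j ^ (2 * CARD('d)))" by (simp only: of_nat_le_iff)
    then show "real (card ?I) \<le> real (S j) ^ (2 * CARD('d))" by (simp only: of_nat_power)
  qed simp
  also have "\<dots> \<le> bad_bound \<rho> (Suc j)" by (rule bad_bound_step[OF \<rho>])
  finally show ?case .
qed

lemma bad_bound_nonneg: "0 \<le> \<rho> \<Longrightarrow> 0 \<le> bad_bound \<rho> j"
  by (simp add: bad_bound_def)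

lemma card_bad_bound:
  assumes "0 \<le> \<rho>" shows "real (S j ^ CARD('d)) * bad_bound \<rho> j \<le> \<rho> * (1 / 2) ^ j"
proof -
  have "real (S j) ^ CARD('d) \<ge> 1" using S_ge[of j] by (intro one_le_power) simp
  moreover have "real (S j ^ CARD('d)) * bad_bound \<rho> j = \<rho> * (1 / 2) ^ j / real (S j) ^ CARD('d)"
    using S_pos by (simp add: bad_bound_def mult_2 power_add)
  moreover have "\<rho> * (1 / 2) ^ j / s \<le> \<rho> * (1 / 2) ^ j / 1" if "s \<ge> 1" for s :: real
    using that assms by (intro divide_left_mono) auto
  ultimately show ?thesis by simp
qed

lemma pr_some_bad:
  assumes obs: "\<And>z. observable (V z) (\<lambda>x. G x z)" and disj: "\<And>z z'. z \<noteq> z' \<Longrightarrow> V z \<inter> V z' = {}"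
    and \<rho>: "0 \<le> \<rho>" "\<rho> \<le> 1 / (16 * 4 ^ CARD('d))"
    and base: "\<And>z. pr (\<lambda>x. \<not> G x z) \<le> bad_bound \<rho> 0"
    and I: "finite I" "card I \<le> c * S j ^ CARD('d)"
  shows "pr (\<lambda>x. \<exists>y\<in>I. \<not> good (G x) j y) \<le> real c * (\<rho> * (1 / 2) ^ j)"
proof -
  have "pr (\<lambda>x. \<exists>y\<in>I. \<not> good (G x) j y) \<le> (\<Sum>y\<in>I. pr (\<lambda>x. \<not> good (G x) j y))"
    by (rule pr_bex_le[OF I(1), where V = UNIV])
      (rule observable_mono[OF observable_not[OF observable_good[OF obs]]], simp)
  also have "\<dots> \<le> (\<Sum>y\<in>I. bad_bound \<rho> j)" by (intro sum_mono pr_bad[OF obs disj \<rho> base])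
  also have "\<dots> = real (card I) * bad_bound \<rho> j" by simp
  also have "\<dots> \<le> real (c * S j ^ CARD('d)) * bad_bound \<rho> j"
    using I(2) bad_bound_nonneg[OF \<rho>(1)] by (intro mult_right_mono) (simp_all only: of_nat_le_iff)
  also have "\<dots> = real c * (real (S j ^ CARD('d)) * bad_bound \<rho> j)" by simp
  also have "\<dots> \<le> real c * (\<rho> * (1 / 2) ^ j)"
    by (intro mult_left_mono card_bad_bound \<rho>(1)) simp
  finally show ?thesis .
qed

lemma pr_nested_cells_good:
  assumes obs: "\<And>z. observable (V z) (\<lambda>x. G x z)" and disj: "\<And>z z'. z \<noteq> z' \<Longrightarrow> V z \<inter> V z' = {}"
    and \<rho>: "0 \<le> \<rho>" "\<rho> \<le> 1 / (16 * 4 ^ CARD('d))"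
    and base: "\<And>z. pr (\<lambda>x. \<not> G x z) \<le> bad_bound \<rho> 0"
  shows "pr (\<lambda>x. \<forall>j. \<forall>y\<in>cell (S j) 0. good (G x) j y) > 0"
    and "observable UNIV (\<lambda>x. \<forall>j. \<forall>y\<in>cell (S j) 0. good (G x) j y)"
proof -
  have o1: "observable UNIV (\<lambda>x. \<forall>y\<in>cell (S j) 0. good (G x) j y)" for j
    by (intro observable_ball finite_cell S_pos observable_mono[OF observable_good[OF obs]]) simp
  show o2: "observable UNIV (\<lambda>x. \<forall>j. \<forall>y\<in>cell (S j) 0. good (G x) j y)"
    by (rule observable_all_nat[OF o1])
  have "pr (\<lambda>x. \<exists>j. \<not> (\<forall>y\<in>cell (S j) 0. good (G x) j y)) \<le> 2 * \<rho>"
  proof (rule pr_ex_nat_le)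
    show "observable UNIV (\<lambda>x. \<not> (\<forall>y\<in>cell (S j) 0. good (G x) j y))" for j
      by (rule observable_not[OF o1])
    have "pr (\<lambda>x. \<exists>y\<in>cell (S j) 0. \<not> good (G x) j y) \<le> real 1 * (\<rho> * (1 / 2) ^ j)" for j
      by (rule pr_some_bad[OF obs disj \<rho> base]) (simp_all add: finite_cell card_cell)
    then show "pr (\<lambda>x. \<not> (\<forall>y\<in>cell (S j) 0. good (G x) j y)) \<le> \<rho> * (1 / 2) ^ j" for j by simp
    have "(\<lambda>j. (1 / 2 :: real) ^ j) sums (1 / (1 - 1 / 2))" by (rule geometric_sums) simp
    from sums_mult[OF this, of \<rho>] show "(\<lambda>j. \<rho> * (1 / 2) ^ j) sums (2 * \<rho>)" by (simp add: mult.commute)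
  qed
  also have "2 * \<rho> < 1"
  proof -
    have "(4::real) ^ CARD('d) \<ge> 1" by simp
    then have "1 / (16 * 4 ^ CARD('d)) \<le> (1 / 16 :: real)" by (simp add: field_simps)
    then show ?thesis using \<rho>(2) by linarith
  qed
  finally have "pr (\<lambda>x. \<not> (\<forall>j. \<forall>y\<in>cell (S j) 0. good (G x) j y)) < 1" by simp
  then show "pr (\<lambda>x. \<forall>j. \<forall>y\<in>cell (S j) 0. good (G x) j y) > 0"
    unfolding pr_not[OF o2] by simp
qed

subsection \<open>Ladders from the first heavy animal\<close>

context
  fixes K \<rho> :: real
  assumes \<rho>: "0 \<le> \<rho>" "\<rho> \<le> 1 / (16 * 4 ^ CARD('d))"
    and base: "\<And>v. pr (\<lambda>x. \<not> - K \<le> x v) \<le> bad_bound \<rho> 0"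
begin

lemma observable_site: "observable {v} (\<lambda>x. - K \<le> x v)"
  by (rule observable_site_ge)

lemma observable_site_good: "observable (cell (scale j) z) (\<lambda>x. good (\<lambda>v. - K \<le> x v) j z)"
  using observable_good[of "\<lambda>v. {v}" "\<lambda>x v. - K \<le> x v", OF observable_site] by simp

lemma observable_ladder:
  assumes "\<And>j y. j < k \<Longrightarrow> y \<in> block j v \<Longrightarrow> cell (scale j) y \<subseteq> V"
  shows "observable V (\<lambda>x. ladder (\<lambda>v. - K \<le> x v) k v)"
proof -
  have "observable V (\<lambda>x. \<forall>j\<in>{..<k}. \<forall>y\<in>block j v. good (\<lambda>v. - K \<le> x v) j y)"
    using assms by (intro observable_ball finite_block observable_mono[OF observable_site_good]) auto
  then show ?thesis by (simp add: ladder_def Ball_def)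
qed

lemma pr_not_ladder: "pr (\<lambda>x. \<not> ladder (\<lambda>v. - K \<le> x v) k v) \<le> 4 * \<rho>"
proof -
  let ?B = "\<lambda>j x. \<exists>y\<in>block j v. \<not> good (\<lambda>v. - K \<le> x v) j y"
  have oB: "observable UNIV (?B j)" for j
    by (intro observable_bex finite_block observable_not observable_mono[OF observable_site_good]) auto
  have "pr (\<lambda>x. \<not> ladder (\<lambda>v. - K \<le> x v) k v) \<le> pr (\<lambda>x. \<exists>j\<in>{..<k}. ?B j x)"
    by (rule pr_mono[where V = UNIV]) (auto intro!: observable_bex oB simp: ladder_def)
  also have "\<dots> \<le> (\<Sum>j\<in>{..<k}. pr (?B j))" by (rule pr_bex_le[OF _ oB]) simp
  also have "\<dots> \<le> (\<Sum>j\<in>{..<k}. real 2 * (\<rho> * (1 / 2) ^ j))"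
    by (intro sum_mono pr_some_bad[OF observable_site _ \<rho> base] finite_block card_block) auto
  also have "\<dots> = 2 * \<rho> * (\<Sum>j<k. (1 / 2) ^ j)" by (simp add: sum_distrib_left mult.assoc)
  also have "(\<Sum>j<k. (1 / 2 :: real) ^ j) = 2 - 2 * (1 / 2) ^ k" by (induction k) auto
  then have "(\<Sum>j<k. (1 / 2 :: real) ^ j) \<le> 2" by simp
  then have "2 * \<rho> * (\<Sum>j<k. (1 / 2) ^ j) \<le> 2 * \<rho> * 2" using \<rho> by (intro mult_left_mono) auto
  finally show ?thesis by simp
qed

lemma observable_laddered:
  assumes "finite V" "V \<subseteq> W" "\<And>v j y. v \<in> V \<Longrightarrow> j < k \<Longrightarrow> y \<in> block j v \<Longrightarrow> cell (scale j) y \<subseteq> W"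
  shows "observable W (laddered K t k V)"
proof -
  have "observable W (\<lambda>x. \<exists>v\<in>V. ladder (\<lambda>v. - K \<le> x v) k v \<and>
     (\<exists>\<xi>. lattice_animal \<xi> \<and> \<xi> \<subseteq> V \<and> v \<in> \<xi> \<and> animal_weight x \<xi> \<ge> t))"
    using assms by (intro observable_bex observable_conj observable_ladder
      observable_mono[OF observable_animal_bex]) auto
  then show ?thesis by (simp add: laddered_def[abs_def])
qed

text \<open>Induction over the sites of \<open>V\<close> in decreasing order of the coordinate \<open>m\<close>. When a site \<open>v\<close> makes \<open>V\<close>
  heavy for the first time, it belongs to a heavy animal; this event concerns sites at least as high
  as \<open>v\<close>, whereas the ladder of \<open>v\<close> concerns sites strictly below \<open>v\<close>. So each increment of the
  probability of being heavy is multiplied by the probability of a missing ladder.\<close>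

lemma pr_heavy_not_laddered:
  assumes "finite V"
  shows "pr (\<lambda>x. heavy t V x \<and> \<not> laddered K t k V x) \<le> 4 * \<rho> * pr (heavy t V)"
  using assms
proof (induction V rule: finite_ranking_induct[where f = "\<lambda>v. - v $ m"])
  case empty
  have "\<not> heavy t {} x" for x :: "int ^ 'd \<Rightarrow> real" by (auto simp: heavy_def lattice_animal_def)
  then have "heavy t ({} :: (int ^ 'd) set) = (\<lambda>x. False)" by (simp add: fun_eq_iff)
  then show ?case by (simp add: pr_def)
next
  case (insert v V)
  let ?W = "insert v V"
  let ?new = "\<lambda>x. heavy t ?W x \<and> \<not> heavy t V x"
  let ?nl = "\<lambda>x. \<not> ladder (\<lambda>v. - K \<le> x v) k v"
  have fin: "finite V" "finite ?W" using insert by auto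
  have oV: "observable ?W (heavy t V)" and oW: "observable ?W (heavy t ?W)"
    using observable_heavy[OF fin(1)] observable_heavy[OF fin(2)] by (auto intro: observable_mono)
  have onew: "observable ?W ?new" by (intro observable_conj observable_not oV oW)
  have oll: "observable UNIV (\<lambda>x. heavy t V x \<and> \<not> laddered K t k V x)"
    by (intro observable_conj observable_not observable_laddered observable_mono[OF oV]) (use fin in auto)
  have onl: "observable {w. w $ m < v $ m} ?nl"
    by (intro observable_not observable_ladder) (use block_below in blast)
  have disj: "?W \<inter> {w. w $ m < v $ m} = {}" using insert.hyps by force
  have oboth: "observable UNIV (\<lambda>x. ?new x \<and> ?nl x)"
    by (rule observable_conj) (rule observable_mono[OF onew] observable_mono[OF onl]; simp)+
  have "pr (\<lambda>x. heavy t ?W x \<and> \<not> laddered K t k ?W x)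
      \<le> pr (\<lambda>x. (heavy t V x \<and> \<not> laddered K t k V x) \<or> (?new x \<and> ?nl x))"
  proof (rule pr_mono)
    have "observable UNIV (\<lambda>x. \<not> (\<not> (heavy t V x \<and> \<not> laddered K t k V x) \<and> \<not> (?new x \<and> ?nl x)))"
      by (intro observable_not observable_conj[OF observable_not[OF oll] observable_not[OF oboth]])
    then show "observable UNIV (\<lambda>x. (heavy t V x \<and> \<not> laddered K t k V x) \<or> (?new x \<and> ?nl x))" by simp
    fix x assume x: "heavy t ?W x \<and> \<not> laddered K t k ?W x"
    show "(heavy t V x \<and> \<not> laddered K t k V x) \<or> (?new x \<and> ?nl x)"
    proof (cases "heavy t V x")
      case True
      then show ?thesis using x laddered_mono[of V ?W K t k x] by blast
    next
      case False
      obtain \<xi> where \<xi>: "lattice_animal \<xi>" "\<xi> \<subseteq> ?W" "animal_weight x \<xi> \<ge> t"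
        using x by (auto simp: heavy_def)
      have "v \<in> \<xi>"
      proof (rule ccontr)
        assume "v \<notin> \<xi>"
        then have "\<xi> \<subseteq> V" using \<xi>(2) by auto
        then show False using False \<xi> by (auto simp: heavy_def)
      qed
      then have "?nl x" using x \<xi> unfolding laddered_def by blast
      then show ?thesis using x False by simp
    qed
  qed
  also have "\<dots> \<le> pr (\<lambda>x. heavy t V x \<and> \<not> laddered K t k V x) + pr (\<lambda>x. ?new x \<and> ?nl x)"
    by (rule pr_disj_le[OF oll oboth])
  also have "pr (\<lambda>x. ?new x \<and> ?nl x) = pr ?new * pr ?nl" by (rule pr_conj_indep[OF onew onl disj])
  also have "pr ?new * pr ?nl \<le> pr ?new * (4 * \<rho>)"
    by (intro mult_left_mono pr_not_ladder pr_nonneg)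
  also have "pr (\<lambda>x. heavy t V x \<and> \<not> laddered K t k V x) \<le> 4 * \<rho> * pr (heavy t V)"
    by (rule insert.IH)
  also have "4 * \<rho> * pr (heavy t V) + pr ?new * (4 * \<rho>) = 4 * \<rho> * pr (heavy t ?W)"
  proof -
    have "pr (heavy t ?W) = pr (heavy t V) + pr ?new"
    proof -
      have "{\<omega> \<in> space M. heavy t ?W (\<lambda>v. X v \<omega>)} =
          {\<omega> \<in> space M. heavy t V (\<lambda>v. X v \<omega>)} \<union> {\<omega> \<in> space M. ?new (\<lambda>v. X v \<omega>)}"
        using heavy_mono[of V ?W t] by auto
      then show ?thesis unfolding pr_def
        using finite_measure_Union[OF obs_event[OF oV] obs_event[OF onew]] by auto
    qed
    then show ?thesis by (simp add: algebra_simps)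
  qed
  finally show ?case by simp
qed

end

end

section \<open>Zero growth forbids heavy boxes\<close>

lemma finite_lattice_box: "finite (lattice_box n :: (int ^ 'd::finite) set)"
  and card_lattice_box: "card (lattice_box n :: (int ^ 'd::finite) set) = n ^ CARD('d)"
proof -
  have "lattice_box n = {v :: int ^ 'd. \<forall>i. 0 \<le> v $ i \<and> v $ i < int n}"
    by (auto simp: lattice_box_def)
  then show "finite (lattice_box n :: (int ^ 'd) set)"
    "card (lattice_box n :: (int ^ 'd) set) = n ^ CARD('d)"
    by (simp_all add: finite_card_orthotope_product)
qed

lemma (in hierarchy) block_inner:
  assumes "v \<in> inner k z" "j < k" "y \<in> block j v"
  shows "cell (scale j) y \<subseteq> cell (scale (Suc k)) z"
proof -
  have "cell (scale j) y \<subseteq> strip (Suc j) v" by (rule block_in_strip[OF assms(3)])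
  also have "\<dots> \<subseteq> strip k v" using assms(2) by (intro strip_mono) simp
  also have "\<dots> \<subseteq> cell (scale (Suc k)) z" using assms(1) by (intro strip_in_cell) (auto simp: inner_def)
  finally show ?thesis .
qed

lemma (in hierarchy) inner_subset: "inner k z \<subseteq> cell (scale (Suc k)) z"
  by (auto simp: inner_def)

lemma (in hierarchy) finite_inner: "finite (inner k z)"
  by (rule finite_subset[OF inner_subset]) (simp add: finite_cell)

lemma (in hierarchy) mem_innerI:
  assumes "\<And>i. int (scale (Suc k)) * z $ i + int (scale k) \<le> v $ i"
    and "\<And>i. v $ i < int (scale (Suc k)) * z $ i + int (scale (Suc k))"
  shows "v \<in> inner k z"
proof -
  have v: "v \<in> cell (scale (Suc k)) z"
    unfolding mem_cell_iff[OF scale_pos]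
    using assms by (metis add.commute add_increasing2 le_add_same_cancel1 of_nat_0_le_iff order_trans)
  have "left k v \<in> cell (S k) z"
    unfolding mem_cell_iff[OF S_pos]
  proof
    fix i
    let ?l = "int (scale k)" and ?s = "int (S k)"
    have l: "?l > 0" by simp
    have "?l * (?s * z $ i + 1) \<le> v $ i" using assms(1)[of i] by (simp add: scale_Suc algebra_simps)
    then have "(?l * (?s * z $ i + 1)) div ?l \<le> v $ i div ?l" using l by (intro zdiv_mono1)
    then have lo: "?s * z $ i + 1 \<le> v $ i div ?l" using l by simp
    have "coarse (scale k) v \<in> cell (S k) z"
      using v by (simp add: cell_def coarse_coarse scale_Suc)
    then have "v $ i div ?l < ?s * z $ i + ?s" unfolding mem_cell_iff[OF S_pos] by simp
    then show "?s * z $ i \<le> left k v $ i \<and> left k v $ i < ?s * z $ i + ?s"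
      using lo by (auto simp: left_def axis_apply)
  qed
  with v show ?thesis by (simp add: inner_def)
qed

context iid_hierarchy
begin

text \<open>The inner part of a cell contains a grid of \<open>J ^ d\<close> disjoint translates of the box of side \<open>n\<close>.\<close>

lemma pr_not_heavy_inner:
  assumes n: "n \<ge> 1" and J: "J * n + scale k \<le> scale (Suc k)"
  shows "pr (\<lambda>x. \<not> heavy t (inner k z) x)
    \<le> (1 - pr (heavy t (lattice_box n :: (int ^ 'd) set))) ^ (J ^ CARD('d))"
proof -
  let ?B = "lattice_box n :: (int ^ 'd) set" and ?I = "lattice_box J :: (int ^ 'd) set"
  define corner where "corner b = (\<chi> i. int (scale (Suc k)) * z $ i + int (scale k) + int n * b $ i)"
    for b :: "int ^ 'd"
  define W where "W b = (\<lambda>v. v + corner b) ` ?B" for b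
  have W_sub: "W b \<subseteq> inner k z" if b: "b \<in> ?I" for b
  proof
    fix v assume "v \<in> W b"
    then obtain u where u: "u \<in> ?B" "v = u + corner b" by (auto simp: W_def)
    show "v \<in> inner k z"
    proof (rule mem_innerI)
      fix i
      have ui: "0 \<le> u $ i" "u $ i < int n" and bi: "0 \<le> b $ i" "b $ i < int J"
        using u b by (auto simp: lattice_box_def)
      have "int n * b $ i \<ge> 0" using bi by simp
      then show "int (scale (Suc k)) * z $ i + int (scale k) \<le> v $ i"
        using ui by (simp add: u corner_def)
      have "int n * (b $ i + 1) \<le> int n * int J" using bi by (intro mult_left_mono) auto
      also have "int n * int J + int (scale k) \<le> int (scale (Suc k))"
        using J by (metis mult.commute of_nat_add of_nat_le_iff of_nat_mult)
      finally show "v $ i < int (scale (Suc k)) * z $ i + int (scale (Suc k))"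
        using ui by (simp add: u corner_def algebra_simps)
    qed
  qed
  have W_disj: "W b \<inter> W b' = {}" if ne: "b \<noteq> b'" for b b'
  proof (rule ccontr)
    assume "W b \<inter> W b' \<noteq> {}"
    then obtain u u' where u: "u \<in> ?B" "u' \<in> ?B" "u + corner b = u' + corner b'" by (auto simp: W_def)
    have "b $ i = b' $ i" for i
    proof -
      have "u $ i + int n * b $ i = u' $ i + int n * b' $ i"
        using arg_cong[OF u(3), of "\<lambda>v. v $ i"] by (simp add: corner_def)
      then have "(u $ i + int n * b $ i) div int n = (u' $ i + int n * b' $ i) div int n" by simp
      then show ?thesis using u(1,2) n by (simp add: lattice_box_def)
    qed
    then show False using ne by (simp add: vec_eq_iff)
  qed
  have oW: "observable (W b) (heavy t (W b))" for b
    by (rule observable_heavy) (simp add: W_def finite_lattice_box)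
  have "pr (\<lambda>x. \<not> heavy t (inner k z) x) \<le> pr (\<lambda>x. \<forall>b\<in>?I. \<not> heavy t (W b) x)"
  proof (rule pr_mono)
    show "observable UNIV (\<lambda>x. \<forall>b\<in>?I. \<not> heavy t (W b) x)"
      by (intro observable_ball finite_lattice_box observable_not observable_mono[OF oW]) auto
  qed (use heavy_mono[OF W_sub] in blast)
  also have "\<dots> = (\<Prod>b\<in>?I. pr (\<lambda>x. \<not> heavy t (W b) x))"
    by (rule pr_ball_indep[OF finite_lattice_box observable_not[OF oW] W_disj])
  also have "\<dots> = (\<Prod>b\<in>?I. 1 - pr (heavy t ?B))"
    by (intro prod.cong refl)
      (simp add: pr_not[OF oW], simp add: W_def pr_heavy_translate[OF finite_lattice_box])
  also have "\<dots> = (1 - pr (heavy t ?B)) ^ (J ^ CARD('d))" by (simp add: card_lattice_box)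
  finally show ?thesis .
qed

lemma
  assumes \<rho>: "0 \<le> \<rho>" "\<rho> \<le> 1 / (16 * 4 ^ CARD('d))"
    and base: "\<And>v. pr (\<lambda>x. \<not> - K \<le> x v) \<le> bad_bound \<rho> 0"
  shows observable_rich: "observable (cell (scale (Suc k)) z) (\<lambda>x. rich K t k x z)"
    and pr_not_rich: "pr (\<lambda>x. \<not> rich K t k x z) \<le> 5 * \<rho> + pr (\<lambda>x. \<not> heavy t (inner k z) x)"
proof -
  let ?C = "cell (scale (Suc k)) z"
  let ?bad = "\<lambda>x. \<exists>y\<in>cell (S k) z. \<not> good (\<lambda>v. - K \<le> x v) k y"
  let ?hl = "\<lambda>x. heavy t (inner k z) x \<and> \<not> laddered K t k (inner k z) x"
  have obad: "observable ?C ?bad"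
    using cell_subset_cell_mult[of _ "S k" z "scale k"]
    by (intro observable_bex finite_cell S_pos observable_not observable_mono[OF observable_site_good[OF \<rho> base]])
      (simp add: scale_Suc)
  have olad: "observable ?C (laddered K t k (inner k z))"
    by (rule observable_laddered[OF \<rho> base finite_inner inner_subset block_inner])
  have oheavy: "observable ?C (heavy t (inner k z))"
    by (rule observable_mono[OF observable_heavy[OF finite_inner] inner_subset])
  have ohl: "observable ?C ?hl" by (intro observable_conj observable_not olad oheavy)
  have "observable ?C (\<lambda>x. \<not> ?bad x \<and> laddered K t k (inner k z) x)"
    by (intro observable_conj observable_not olad obad)
  then show "observable ?C (\<lambda>x. rich K t k x z)" by (simp add: rich_def)
  have ohn: "observable ?C (\<lambda>x. ?hl x \<or> \<not> heavy t (inner k z) x)"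
  proof -
    have "observable ?C (\<lambda>x. \<not> (\<not> ?hl x \<and> heavy t (inner k z) x))"
      by (intro observable_conj[OF observable_not[OF ohl] oheavy, THEN observable_not])
    then show ?thesis by simp
  qed
  have "pr (\<lambda>x. \<not> rich K t k x z) \<le> pr (\<lambda>x. ?bad x \<or> (?hl x \<or> \<not> heavy t (inner k z) x))"
  proof (rule pr_mono)
    have "observable ?C (\<lambda>x. \<not> (\<not> ?bad x \<and> \<not> (?hl x \<or> \<not> heavy t (inner k z) x)))"
      by (intro observable_conj[OF observable_not[OF obad] observable_not[OF ohn], THEN observable_not])
    then show "observable ?C (\<lambda>x. ?bad x \<or> (?hl x \<or> \<not> heavy t (inner k z) x))" by simp
  qed (auto simp: rich_def)
  also have "\<dots> \<le> pr ?bad + pr (\<lambda>x. ?hl x \<or> \<not> heavy t (inner k z) x)" by (rule pr_disj_le[OF obad ohn])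
  also have "pr (\<lambda>x. ?hl x \<or> \<not> heavy t (inner k z) x) \<le> pr ?hl + pr (\<lambda>x. \<not> heavy t (inner k z) x)"
    by (rule pr_disj_le[OF ohl observable_not[OF oheavy]])
  also have "pr ?bad \<le> real 1 * (\<rho> * (1 / 2) ^ k)"
    by (rule pr_some_bad[OF observable_site[OF \<rho> base] _ \<rho> base]) (auto simp: finite_cell card_cell)
  also have "real 1 * (\<rho> * (1 / 2) ^ k) \<le> \<rho>"
    using \<rho>(1) by (simp add: mult_left_le power_le_one)
  also have "pr ?hl \<le> 4 * \<rho> * pr (heavy t (inner k z))"
    by (rule pr_heavy_not_laddered[OF \<rho> base finite_inner])
  also have "\<dots> \<le> 4 * \<rho> * 1" using \<rho>(1) pr_le_1 by (intro mult_left_mono) auto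
  finally show "pr (\<lambda>x. \<not> rich K t k x z) \<le> 5 * \<rho> + pr (\<lambda>x. \<not> heavy t (inner k z) x)" by simp
qed

text \<open>If all cells of level \<open>k + 1\<close> were rich with high probability, the second hierarchy would give, with
  positive probability, arbitrarily large clusters of rich cells and hence positive growth. So
  the independent boxes inside a cell all fail with probability bounded below, that is,
  \<open>(1 - p) ^ (J ^ d) > \<epsilon> / 2\<close> for the probability \<open>p\<close> of a heavy box, which bounds \<open>p * J ^ d\<close>. If the
  side of the cell is less than \<open>2 * n\<close>, the bound exceeds one.\<close>

lemma no_growth_no_heavy:
  assumes growth: "AE \<omega> in M. (\<lambda>n. max_weight_size (\<lambda>v. X v \<omega>) n / real n) \<longlonglongrightarrow> 0"
  obtains C1 C2 :: real where "C1 \<ge> 1" "C2 > 0"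
    "\<And>n k t. n \<ge> 1 \<Longrightarrow> t \<ge> C1 * real (reach (Suc k)) \<Longrightarrow>
       pr (heavy t (lattice_box n :: (int ^ 'd) set)) \<le> C2 * (real n / real (scale (Suc k))) ^ CARD('d)"
proof -
  let ?d = "CARD('d)"
  define \<rho>\<^sub>0 :: real where "\<rho>\<^sub>0 = 1 / (16 * 4 ^ ?d)"
  define \<epsilon> where "\<epsilon> = bad_bound \<rho>\<^sub>0 0"
  \<comment> \<open>\<open>\<epsilon>\<close> is the tolerated probability of a cell that is not rich. The failure of the network and of the ladder
    uses \<open>5 * \<rho>\<close>, half of it.\<close>
  define \<rho> where "\<rho> = \<epsilon> / 10"
  have \<rho>0: "0 \<le> \<rho>\<^sub>0" "\<rho>\<^sub>0 \<le> 1 / (16 * 4 ^ ?d)" by (simp_all add: \<rho>\<^sub>0_def)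
  have \<epsilon>: "\<epsilon> > 0" using S_pos by (simp add: \<epsilon>_def bad_bound_def \<rho>\<^sub>0_def)
  have "real (S 0) ^ (2 * ?d) \<ge> 1" using S_ge[of 0] by (intro one_le_power) simp
  then have "\<epsilon> \<le> \<rho>\<^sub>0 / 1"
    unfolding \<epsilon>_def bad_bound_def using \<rho>0(1) by (simp only: power_0 mult_1_right) (rule divide_left_mono, auto)
  then have \<rho>: "0 \<le> \<rho>" "\<rho> \<le> 1 / (16 * 4 ^ ?d)" using \<epsilon> \<rho>0 by (simp_all add: \<rho>_def)
  have "bad_bound \<rho> 0 > 0" using \<epsilon> S_pos by (simp add: bad_bound_def \<rho>_def)
  from pr_site_below[OF this] obtain K where K: "K \<ge> 0"
    and base: "\<And>v. pr (\<lambda>x. \<not> - K \<le> x v) \<le> bad_bound \<rho> 0" by blast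
  have key: "\<epsilon> / 2 < (1 - pr (heavy t (lattice_box n :: (int ^ 'd) set))) ^ (J ^ ?d)"
    if n: "n \<ge> 1" and J: "J * n + scale k \<le> scale (Suc k)" and t: "t \<ge> K * real (link_cost k) + 1" for n k t J
  proof (rule ccontr)
    assume "\<not> ?thesis"
    then have small: "pr (\<lambda>x. \<not> heavy t (inner k z) x) \<le> \<epsilon> / 2" for z
      using pr_not_heavy_inner[OF n J, of t z] by linarith
    have "pr (\<lambda>x. \<not> rich K t k x z) \<le> bad_bound \<rho>\<^sub>0 0" for z
      using pr_not_rich[OF \<rho> base, where k = k and z = z and t = t] small[of z] by (simp add: \<rho>_def \<epsilon>_def)
    note * = pr_nested_cells_good[where G = "rich K t k", OF observable_rich[OF \<rho> base] cell_disjoint \<rho>0 this]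
    have "AE \<omega> in M. \<not> (\<forall>j. \<forall>y\<in>cell (S j) 0. good (rich K t k (\<lambda>v. X v \<omega>)) j y)"
      using growth
    proof eventually_elim
      case (elim \<omega>)
      then show ?case using rich_clusters_positive_growth[OF K t, of "\<lambda>v. X v \<omega>"] by blast
    qed
    then have "pr (\<lambda>x. \<forall>j. \<forall>y\<in>cell (S j) 0. good (rich K t k x) j y) = 0"
      unfolding pr_def using obs_event[OF *(2)] prob_eq_0[OF obs_event[OF *(2)]] by simp
    then show False using *(1) by simp
  qed
  define C1 where "C1 = K * real (5 * ?d + 2) + 1"
  define L where "L = max 1 (ln (2 / \<epsilon>))"
  show ?thesis
  proof (rule that[of C1 "L * 4 ^ ?d"])
    show "C1 \<ge> 1" using K by (simp add: C1_def)
    show "L * 4 ^ ?d > 0" by (simp add: L_def)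
    fix n k t assume n: "n \<ge> (1::nat)" and t: "t \<ge> C1 * real (reach (Suc k))"
    let ?p = "pr (heavy t (lattice_box n :: (int ^ 'd) set))"
    let ?R = "scale (Suc k)"
    have r1: "real (reach (Suc k)) \<ge> 1" using sum_S_reach[of "Suc k"] by linarith
    have "K * real (link_cost k) + 1 \<le> C1 * real (reach (Suc k))"
    proof -
      have "link_cost k \<le> (5 * ?d + 2) * reach (Suc k)"
        using sum_S_reach[of "Suc k"] mult_le_mono2[of 1 "reach (Suc k)" "2 * ?d"]
        by (simp add: link_cost_def algebra_simps)
      then have "K * real (link_cost k) \<le> K * real ((5 * ?d + 2) * reach (Suc k))"
        using K by (intro mult_left_mono) (simp_all only: of_nat_le_iff)
      then show ?thesis using r1 by (simp add: C1_def algebra_simps)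
    qed
    then have t': "t \<ge> K * real (link_cost k) + 1" using t by linarith
    have rhs: "L * 4 ^ ?d * (real n / real ?R) ^ ?d = L * (4 * real n / real ?R) ^ ?d"
      by (simp add: power_mult_distrib power_divide)
    have R0: "real ?R > 0" by simp
    show "?p \<le> L * 4 ^ ?d * (real n / real ?R) ^ ?d"
    proof (cases "2 * n \<le> ?R")
      case False
      then have "1 \<le> 4 * real n / real ?R" by (simp add: le_divide_eq)
      then have "1 \<le> (4 * real n / real ?R) ^ ?d" by (rule one_le_power)
      then have "1 * 1 \<le> L * (4 * real n / real ?R) ^ ?d" by (intro mult_mono) (auto simp: L_def)
      then show ?thesis unfolding rhs using pr_le_1[of "heavy t (lattice_box n :: (int ^ 'd) set)"] by linarith
    next
      case True
      define J where "J = (?R - scale k) div n"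
      have s5: "5 * scale k \<le> ?R" unfolding scale_Suc using S_ge[of k] by (simp add: mult.commute)
      have J: "J * n + scale k \<le> ?R"
      proof -
        have "J * n \<le> ?R - scale k" by (simp add: J_def)
        then show ?thesis using s5 by linarith
      qed
      have "?R - scale k < (J + 1) * n"
        using n dividend_less_div_times[of n "?R - scale k"] by (simp add: J_def algebra_simps)
      then have "?R < (J + 1) * n + scale k" using s5 by linarith
      then have "real ?R < real ((J + 1) * n + scale k)" by (simp only: of_nat_less_iff)
      then have "real ?R - real (scale k) < (real J + 1) * real n" by (simp add: algebra_simps)
      moreover have "real (scale k) \<le> real ?R / 5" using s5 by linarith
      ultimately have "4 / 5 * real ?R < real J * real n + real n" by (simp add: algebra_simps)
      moreover have "real n \<le> real ?R / 2" using True by linarith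
      ultimately have "real ?R \<le> real J * (4 * real n)" by linarith
      then have Jn: "1 \<le> real J * (4 * real n / real ?R)" using R0 by (simp add: le_divide_eq)
      have p: "0 \<le> ?p" "?p \<le> 1" by (rule pr_nonneg pr_le_1)+
      have "\<epsilon> / 2 < (1 - ?p) ^ (J ^ ?d)" by (rule key[OF n J t'])
      also have "\<dots> \<le> exp (- ?p) ^ (J ^ ?d)"
        using p exp_ge_add_one_self[of "- ?p"] by (intro power_mono) auto
      also have "\<dots> = exp (- (?p * real J ^ ?d))"
        by (simp flip: exp_of_nat_mult add: mult.commute)
      finally have "ln (\<epsilon> / 2) < - (?p * real J ^ ?d)"
        using \<epsilon> by (metis exp_gt_zero half_gt_zero ln_exp ln_less_cancel_iff)
      moreover have "ln (\<epsilon> / 2) = - ln (2 / \<epsilon>)" using \<epsilon> by (simp add: ln_div)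
      ultimately have pJ: "?p * real J ^ ?d \<le> L" by (simp add: L_def)
      have "?p * 1 \<le> ?p * (real J * (4 * real n / real ?R)) ^ ?d"
        using p Jn by (intro mult_left_mono one_le_power) auto
      also have "\<dots> = (?p * real J ^ ?d) * (4 * real n / real ?R) ^ ?d"
        by (simp only: power_mult_distrib[of "real J"] mult.assoc)
      also have "\<dots> \<le> L * (4 * real n / real ?R) ^ ?d" using pJ by (intro mult_right_mono) auto
      finally show ?thesis unfolding rhs by simp
    qed
  qed
qed

end

section \<open>Linearly growing ratios\<close>

lemma half_le_ln_one_plus:
  fixes u :: real
  assumes "0 \<le> u" "u \<le> 1" shows "u / 2 \<le> ln (1 + u)"
proof -
  have "ln (1 / (1 + u)) \<le> 1 / (1 + u) - 1" using assms by (intro ln_le_minus_one) auto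
  then have "u / (1 + u) \<le> ln (1 + u)" using assms by (simp add: ln_div field_simps)
  moreover have "u / 2 \<le> u / (1 + u)" using assms by (intro divide_left_mono) auto
  ultimately show ?thesis by linarith
qed

text \<open>The quotient of the two products is \<open>\<Prod>i<j. 1 + 8 / (A * (i + 1))\<close>, comparable with
  \<open>exp ((8 / A) * \<Sum>i<j. 1 / (i + 1))\<close>. The exponent \<open>16 / A\<close> instead of \<open>8 / A\<close> allows the factorwise
  comparison with \<open>(1 + 1 / (i + 1)) powr (16 / A)\<close>, whose product telescopes.\<close>

lemma prod_linear_ratio_bound:
  fixes A :: nat
  assumes "A \<ge> 1"
  shows "real (\<Prod>i<j. A * (i + 1) + 8) \<le> real (\<Prod>i<j. A * (i + 1)) * real (j + 1) powr (16 / real A)"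
proof (induction j)
  case (Suc j)
  let ?\<theta> = "16 / real A"
  let ?u = "1 / real (j + 1)"
  have "a * b + 8 = (a * b) * (1 + 16 / a / 2 * (1 / b))" if "a > 0" "b > 0" for a b :: real
    using that by (simp add: field_simps)
  from this[of "real A" "real (j + 1)"]
  have "real (A * (j + 1) + 8) = real (A * (j + 1)) * (1 + ?\<theta> / 2 * ?u)"
    using assms by (simp only: of_nat_add of_nat_mult of_nat_numeral)
  also have "1 + ?\<theta> / 2 * ?u \<le> exp (?\<theta> / 2 * ?u)" by (rule exp_ge_add_one_self)
  also have "\<dots> \<le> exp (?\<theta> * ln (1 + ?u))"
  proof -
    have "?u / 2 \<le> ln (1 + ?u)" by (rule half_le_ln_one_plus) auto
    then have "?\<theta> * (?u / 2) \<le> ?\<theta> * ln (1 + ?u)" by (rule mult_left_mono) simp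
    moreover have "a / 2 * b = a * (b / 2)" for a b :: real by simp
    ultimately show ?thesis by (simp only: exp_le_cancel_iff)
  qed
  also have "1 + ?u > 0" by (rule add_pos_nonneg) auto
  then have "exp (?\<theta> * ln (1 + ?u)) = (1 + ?u) powr ?\<theta>" by (auto simp: powr_def)
  finally have step: "real (A * (j + 1) + 8) \<le> real (A * (j + 1)) * (1 + ?u) powr ?\<theta>"
    using assms by (simp add: mult_left_mono)
  have "real (\<Prod>i<Suc j. A * (i + 1) + 8) = real (\<Prod>i<j. A * (i + 1) + 8) * real (A * (j + 1) + 8)"
    by simp
  also have "\<dots> \<le> (real (\<Prod>i<j. A * (i + 1)) * real (j + 1) powr ?\<theta>) * (real (A * (j + 1)) * (1 + ?u) powr ?\<theta>)"
    by (intro mult_mono Suc step mult_nonneg_nonneg of_nat_0_le_iff powr_ge_zero)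
  also have "\<dots> = real (\<Prod>i<Suc j. A * (i + 1)) * (real (j + 1) powr ?\<theta> * (1 + ?u) powr ?\<theta>)" by simp
  also have "real (j + 1) powr ?\<theta> * (1 + ?u) powr ?\<theta> = (real (j + 1) * (1 + ?u)) powr ?\<theta>"
    by (simp add: powr_mult)
  also have "real (j + 1) * (1 + ?u) = real (Suc j + 1)" by (simp add: field_simps)
  finally show ?case .
qed simp

text \<open>For \<open>n = 2 ^ m\<close> and \<open>t = \<epsilon> * 2 ^ m * m powr c\<close> take the largest level \<open>k + 1\<close> whose linking length is affordable,
  \<open>C1 * reach (k + 1) \<le> t\<close>. Maximality bounds the side from below by \<open>t\<close> up to a factor of order
  \<open>(k + 2) powr (1 + \<theta>)\<close>: one power for the ratio of consecutive levels, and \<open>\<theta>\<close> for the excess of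
  \<open>reach\<close> over \<open>scale\<close>. Since \<open>k\<close> is at most of order \<open>m\<close>, the quotient of \<open>n\<close> and the side is at most
  of order \<open>m powr (1 + \<theta> - c)\<close>, hence of order \<open>m powr (1 - \<gamma>)\<close>; note \<open>(1 - \<gamma>) * d = - \<gamma>\<close>.\<close>

lemma (in iid_field) pr_heavy_box_rate:
  fixes c \<epsilon> :: real
  defines "\<gamma> \<equiv> real CARD('d) / (real CARD('d) - 1)"
  assumes dim: "CARD('d) \<ge> 2" and c: "c > \<gamma>" and \<epsilon>: "\<epsilon> > 0"
    and growth: "AE \<omega> in M. (\<lambda>n. max_weight_size (\<lambda>v. X v \<omega>) n / real n) \<longlonglongrightarrow> 0"
  obtains C where "eventually (\<lambda>m. pr (heavy (\<epsilon> * 2 ^ m * real m powr c) (lattice_box (2 ^ m)))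
      \<le> C * real m powr (- \<gamma>)) sequentially"
proof -
  let ?d = "CARD('d)"
  have d: "real ?d - 1 > 0" using dim by simp
  have \<gamma>: "\<gamma> > 1" "(1 - \<gamma>) * real ?d = - \<gamma>" using d by (simp_all add: \<gamma>_def field_simps)
  define A where "A = max 5 (nat \<lceil>16 / (c - \<gamma>)\<rceil>)"
  define \<theta> where "\<theta> = 16 / real A"
  have A5: "A \<ge> 5" by (simp add: A_def)
  have "16 / (c - \<gamma>) \<le> real A" unfolding A_def by linarith
  then have "16 \<le> real A * (c - \<gamma>)" using c by (simp add: pos_divide_le_eq)
  then have \<theta>: "\<theta> \<le> c - \<gamma>" "\<theta> > 0" using A5 by (simp_all add: \<theta>_def pos_divide_le_eq mult.commute)
  \<comment> \<open>Any coordinate direction serves for the ladders.\<close>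
  interpret H: iid_hierarchy "\<lambda>j. A * (j + 1)" undefined M X F
    using A5 dim by unfold_locales (auto simp: algebra_simps)
  obtain C1 C2 where C: "C1 \<ge> 1" "C2 > 0"
    and bound: "\<And>n k t. n \<ge> 1 \<Longrightarrow> t \<ge> C1 * real (H.reach (Suc k)) \<Longrightarrow>
       pr (heavy t (lattice_box n)) \<le> C2 * (real n / real (H.scale (Suc k))) ^ ?d"
    using H.no_growth_no_heavy[OF growth] by metis
  define B where "B = C1 * (real A + 8)"
  define D where "D = B / \<epsilon> * 3 powr (1 + \<theta>)"
  have B: "B > 0" using C by (simp add: B_def)
  have reach_pow: "2 ^ j \<le> real (H.reach j)" for j
  proof (induction j)
    case 0
    show ?case unfolding H.reach_0 by simp
  next
    case (Suc j)
    have "2 * 2 ^ j \<le> real (A * (j + 1) + 8) * real (H.reach j)" using Suc by (intro mult_mono) auto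
    then show ?case unfolding H.reach_Suc by simp
  qed
  have rate: "pr (heavy (\<epsilon> * 2 ^ m * real m powr c) (lattice_box (2 ^ m))) \<le> C2 * D ^ ?d * real m powr (- \<gamma>)"
    if m: "m \<ge> 1" and lo: "C1 * real (H.reach 1) \<le> \<epsilon> * 2 ^ m * real m powr c"
      and hi: "\<epsilon> * 2 ^ m * real m powr c \<le> 4 ^ m" for m
  proof -
    define t where "t = \<epsilon> * 2 ^ m * real m powr c"
    have ex: "\<exists>j. t < C1 * real (H.reach j)"
    proof -
      obtain j where "t < 2 ^ j" using real_arch_pow[of 2 t] by auto
      also have "2 ^ j \<le> real (H.reach j)" by (rule reach_pow)
      also have "\<dots> \<le> C1 * real (H.reach j)" using C(1) by (simp add: mult_le_cancel_right1)
      finally show ?thesis ..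
    qed
    define j where "j = (LEAST j. t < C1 * real (H.reach j))"
    have j: "t < C1 * real (H.reach j)" unfolding j_def using ex by (rule LeastI_ex)
    have below: "C1 * real (H.reach i) \<le> t" if "i < j" for i
      using not_less_Least[OF that[unfolded j_def]] by simp
    have "j \<noteq> 1" using j lo by (auto simp: t_def)
    moreover have "j \<noteq> 0"
    proof
      assume j0: "j = 0"
      have "t < C1 * 1" using j unfolding j0 H.reach_0 by simp
      also have "\<dots> \<le> C1 * real (H.reach 1)" using C(1) reach_pow[of 1] by (intro mult_left_mono) auto
      finally show False using lo by (simp add: t_def)
    qed
    ultimately obtain k where k: "j = Suc (Suc k)" by (metis One_nat_def not0_implies_Suc)
    have t_lo: "C1 * real (H.reach (Suc k)) \<le> t" by (rule below) (simp add: k)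
    have "2 ^ (k + 1) \<le> real (H.reach (Suc k))" using reach_pow[of "Suc k"] by simp
    also have "\<dots> \<le> C1 * real (H.reach (Suc k))" using C(1) by (simp add: mult_le_cancel_right1)
    also have "\<dots> \<le> 4 ^ m" using t_lo hi by (simp add: t_def)
    also have "(4::real) ^ m = 2 ^ (2 * m)" by (simp add: power_mult)
    finally have "k + 1 \<le> 2 * m" by (rule power_le_imp_le_exp[rotated]) simp
    then have km: "real (k + 2) \<le> 3 * real m" using m by linarith
    let ?R = "real (H.scale (Suc k))"
    have R: "?R > 0" unfolding of_nat_0_less_iff by (rule H.scale_pos)
    have reach_scale: "real (H.reach (Suc k)) \<le> ?R * real (k + 2) powr \<theta>"
      using prod_linear_ratio_bound[of A "Suc k"] A5
      unfolding H.reach_def H.scale_def \<theta>_def by (simp add: add.commute)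
    have "t < C1 * real (H.reach (Suc (Suc k)))" using j k by simp
    also have "\<dots> = C1 * (real (A * (k + 2) + 8) * real (H.reach (Suc k)))"
      by (subst H.reach_Suc) (simp add: algebra_simps)
    also have "\<dots> \<le> C1 * (((real A + 8) * real (k + 2)) * (?R * real (k + 2) powr \<theta>))"
      using C(1) reach_scale by (intro mult_left_mono mult_mono) (auto simp: algebra_simps)
    also have "\<dots> = B * ?R * real (k + 2) powr (1 + \<theta>)"
      by (simp add: B_def powr_add)
    also have "\<dots> \<le> B * ?R * (3 * real m) powr (1 + \<theta>)"
      using B R km \<theta>(2) by (intro mult_left_mono powr_mono2) auto
    finally have t_hi: "\<epsilon> * 2 ^ m * real m powr c \<le> B * ?R * (3 powr (1 + \<theta>) * real m powr (1 + \<theta>))"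
      by (simp add: t_def powr_mult)
    have "2 ^ m / ?R \<le> D * (real m powr (1 + \<theta>) / real m powr c)"
      using t_hi R \<epsilon> m by (simp add: D_def field_simps)
    also have "real m powr (1 + \<theta>) / real m powr c = real m powr (1 + \<theta> - c)"
      by (simp add: powr_diff)
    also have "D * real m powr (1 + \<theta> - c) \<le> D * real m powr (1 - \<gamma>)"
      using B \<epsilon> m \<theta>(1) by (intro mult_left_mono powr_mono) (auto simp: D_def)
    finally have ratio: "2 ^ m / ?R \<le> D * real m powr (1 - \<gamma>)" .
    have "pr (heavy t (lattice_box (2 ^ m))) \<le> C2 * (real (2 ^ m) / ?R) ^ ?d"
      by (rule bound[OF _ t_lo]) simp
    also have "\<dots> \<le> C2 * (D * real m powr (1 - \<gamma>)) ^ ?d"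
      using ratio C(2) by (intro mult_left_mono power_mono) auto
    also have "\<dots> = C2 * D ^ ?d * (real m powr (1 - \<gamma>)) ^ ?d" by (simp add: power_mult_distrib)
    also have "(real m powr (1 - \<gamma>)) ^ ?d = real m powr ((1 - \<gamma>) * real ?d)"
      using m by (simp add: powr_powr flip: powr_realpow)
    also have "(1 - \<gamma>) * real ?d = - \<gamma>" by (rule \<gamma>(2))
    finally show ?thesis by (simp add: t_def)
  qed
  have c1: "c > 1" using c \<gamma> by linarith
  have "filterlim (\<lambda>m::nat. \<epsilon> * 2 ^ m * real m powr c) at_top sequentially"
    using c1 \<epsilon> by real_asymp
  then have "eventually (\<lambda>m::nat. C1 * real (H.reach 1) \<le> \<epsilon> * 2 ^ m * real m powr c) sequentially"
    by (simp only: filterlim_at_top)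
  moreover have "eventually (\<lambda>m::nat. \<epsilon> * 2 ^ m * real m powr c \<le> 4 ^ m) sequentially"
    using c1 \<epsilon> by real_asymp
  moreover have "eventually (\<lambda>m::nat. m \<ge> 1) sequentially" by (rule eventually_ge_at_top)
  ultimately have "eventually (\<lambda>m. pr (heavy (\<epsilon> * 2 ^ m * real m powr c) (lattice_box (2 ^ m)))
      \<le> C2 * D ^ ?d * real m powr (- \<gamma>)) sequentially"
    by eventually_elim (rule rate)
  then show ?thesis by (rule that)
qed

lemma (in iid_field) AE_eventually_not_heavy:
  fixes c \<epsilon> :: real
  assumes dim: "CARD('d) \<ge> 2" and c: "c > real CARD('d) / (real CARD('d) - 1)" and \<epsilon>: "\<epsilon> > 0"
    and growth: "AE \<omega> in M. (\<lambda>n. max_weight_size (\<lambda>v. X v \<omega>) n / real n) \<longlonglongrightarrow> 0"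
  shows "AE \<omega> in M. eventually (\<lambda>m.
    \<not> heavy (\<epsilon> * 2 ^ m * real m powr c) (lattice_box (2 ^ m)) (\<lambda>v. X v \<omega>)) sequentially"
proof -
  let ?\<gamma> = "real CARD('d) / (real CARD('d) - 1)"
  let ?P = "\<lambda>m. heavy (\<epsilon> * 2 ^ m * real m powr c) (lattice_box (2 ^ m))"
  let ?E = "\<lambda>m. {\<omega> \<in> space M. ?P m (\<lambda>v. X v \<omega>)}"
  have \<gamma>: "?\<gamma> > 1" using dim by simp
  obtain C where C: "eventually (\<lambda>m. pr (?P m) \<le> C * real m powr (- ?\<gamma>)) sequentially"
    using pr_heavy_box_rate[OF dim c \<epsilon> growth] by blast
  have E: "?E m \<in> events" for m
    by (rule obs_event[OF observable_heavy[OF finite_lattice_box]])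
  have "summable (\<lambda>m. prob (?E m))"
  proof (rule summable_comparison_test_ev)
    show "eventually (\<lambda>m. norm (prob (?E m)) \<le> C * real m powr (- ?\<gamma>)) sequentially"
      using C by (simp add: pr_def)
    show "summable (\<lambda>m. C * real m powr (- ?\<gamma>))"
      using \<gamma> by (intro summable_mult) (simp add: summable_real_powr_iff)
  qed
  then have "AE \<omega> in M. eventually (\<lambda>m. \<omega> \<in> space M - ?E m) sequentially"
    by (intro borel_cantelli_AE1 E) (auto simp: emeasure_eq_measure)
  then show ?thesis
  proof eventually_elim
    case (elim \<omega>)
    then show ?case by (rule eventually_mono) auto
  qed
qed

section \<open>From dyadic boxes to all boxes\<close>

lemma
  fixes x :: "int ^ 'd::finite \<Rightarrow> real"
  assumes "n \<ge> 1"
  shows max_weight_box_attained: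
      "\<exists>\<xi>. lattice_animal \<xi> \<and> \<xi> \<subseteq> lattice_box n \<and> animal_weight x \<xi> = max_weight_box x n"
    and max_weight_box_ge_origin: "x 0 \<le> max_weight_box x n"
proof -
  let ?A = "{\<xi> :: (int ^ 'd) set. lattice_animal \<xi> \<and> \<xi> \<subseteq> lattice_box n}"
  have "finite ?A" by (rule finite_subset[of _ "Pow (lattice_box n)"]) (auto simp: finite_lattice_box)
  then have fin: "finite (animal_weight x ` ?A)" by simp
  have origin: "{0} \<in> ?A" using assms by (simp add: lattice_animal_def lattice_box_def)
  have "max_weight_box x n \<in> animal_weight x ` ?A"
    unfolding max_weight_box_def using fin origin by (intro Max_in) auto
  then show "\<exists>\<xi>. lattice_animal \<xi> \<and> \<xi> \<subseteq> lattice_box n \<and> animal_weight x \<xi> = max_weight_box x n" by auto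
  have "animal_weight x {0} \<le> max_weight_box x n"
    unfolding max_weight_box_def using fin origin by (intro Max_ge) auto
  then show "x 0 \<le> max_weight_box x n" by (simp add: animal_weight_def)
qed

text \<open>A box of side \<open>n\<close> lies in the box of side \<open>2 ^ (k + 1)\<close> where \<open>2 ^ k \<le> n < 2 ^ (k + 1)\<close>; the factor
  \<open>2\<close> comes from comparing these sides, and \<open>4 powr c\<close> from \<open>k + 1 \<le> 4 * ln n\<close>.\<close>

lemma max_weight_box_dyadic_bound:
  fixes x :: "int ^ 'd::finite \<Rightarrow> real" and c \<epsilon> :: real
  assumes c: "c > 0" and \<epsilon>: "\<epsilon> > 0"
    and light: "eventually (\<lambda>m. \<not> heavy (\<epsilon> * 2 ^ m * real m powr c) (lattice_box (2 ^ m)) x) sequentially"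
  shows "eventually (\<lambda>n. ln (real n) powr (- c) * (max_weight_box x n / real n) \<le> 2 * \<epsilon> * 4 powr c) sequentially"
proof -
  obtain M where M: "\<And>m. m \<ge> M \<Longrightarrow> \<not> heavy (\<epsilon> * 2 ^ m * real m powr c) (lattice_box (2 ^ m)) x"
    using light by (auto simp: eventually_sequentially)
  have "ln (real n) powr (- c) * (max_weight_box x n / real n) \<le> 2 * \<epsilon> * 4 powr c"
    if n: "n \<ge> 2" "n \<ge> 2 ^ M" for n
  proof -
    obtain k where k: "2 ^ k \<le> n" "n < 2 ^ (k + 1)" using ex_power_ivl1[of 2 n] n(1) by auto
    let ?m = "k + 1"
    have "2 ^ M < (2::nat) ^ ?m" using n(2) k(2) by linarith
    then have "M < ?m" by (rule power_less_imp_less_exp[rotated]) simp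
    then have not_heavy: "\<not> heavy (\<epsilon> * 2 ^ ?m * real ?m powr c) (lattice_box (2 ^ ?m)) x"
      by (intro M) simp
    obtain \<xi> where \<xi>: "lattice_animal \<xi>" "\<xi> \<subseteq> lattice_box n" "animal_weight x \<xi> = max_weight_box x n"
      using max_weight_box_attained[of n x] n(1) by auto
    have "lattice_box n \<subseteq> (lattice_box (2 ^ ?m) :: (int ^ 'd) set)"
    proof -
      have "int n \<le> int (2 ^ ?m)" using k(2) by (simp only: of_nat_le_iff)
      then show ?thesis unfolding lattice_box_def by fastforce
    qed
    then have upper: "max_weight_box x n < \<epsilon> * 2 ^ ?m * real ?m powr c"
      using not_heavy \<xi>(1,2) unfolding heavy_def \<xi>(3)[symmetric] by (meson not_le order_trans)
    have ln_n: "ln (real n) > 0" using n(1) by simp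
    have ln2: "ln (2::real) \<ge> 1 / 2" using half_le_ln_one_plus[of 1] by simp
    have "real k * ln 2 = ln (2 ^ k)" by (simp add: ln_realpow)
    also have "\<dots> \<le> ln (real n)"
    proof -
      have "(2::real) ^ k \<le> real n" 
        using of_nat_mono[OF k(1), where 'a = real] by simp
      then show ?thesis using n(1) by (simp add: ln_le_cancel_iff)
    qed
    finally have "real k * (1 / 2) \<le> ln (real n)"
      using mult_left_mono[OF ln2, of "real k"] by simp
    moreover have "ln 2 \<le> ln (real n)" using n(1) by simp
    then have "1 / 2 \<le> ln (real n)" using ln2 by linarith
    ultimately have "real ?m \<le> 4 * ln (real n)" by simp
    then have "real ?m powr c \<le> (4 * ln (real n)) powr c" using c by (intro powr_mono2) auto
    also have "\<dots> = 4 powr c * ln (real n) powr c" using ln_n by (simp add: powr_mult)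
    finally have mc: "real ?m powr c \<le> 4 powr c * ln (real n) powr c" .
    have "(2::real) ^ ?m \<le> 2 * real n"
      using of_nat_mono[OF k(1), where 'a = real] by simp
    then have "\<epsilon> * 2 ^ ?m * real ?m powr c \<le> (\<epsilon> * (2 * real n)) * (4 powr c * ln (real n) powr c)"
      using mc \<epsilon> by (intro mult_mono) auto
    with upper have "max_weight_box x n \<le> (2 * \<epsilon> * 4 powr c) * (real n * ln (real n) powr c)"
      by (simp add: ac_simps)
    then have "max_weight_box x n / (real n * ln (real n) powr c) \<le> 2 * \<epsilon> * 4 powr c"
      using n(1) ln_n by (simp add: pos_divide_le_eq)
    then show ?thesis by (simp add: powr_minus field_simps)
  qed
  then show ?thesis
    unfolding eventually_sequentially by (intro exI[of _ "max 2 (2 ^ M)"]) auto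
qed

text \<open>The lower bound needs only the animal that consists of the origin; the upper bound is the dyadic
  one for \<open>\<epsilon> = 1 / (i + 1)\<close>.\<close>

theorem theorem1p4:
  fixes M :: "'a measure"
    and X :: "int ^ 'd::finite \<Rightarrow> 'a \<Rightarrow> real"
    and F :: "real \<Rightarrow> real"
    and N c :: real
  assumes dim: "CARD('d) \<ge> 2"
    and prob: "prob_space M"
    and indep: "prob_space.indep_vars M (\<lambda>_. borel) X UNIV"
    and law: "\<And>v. cdf (distr M borel (X v)) = F"
    and tail: "(\<integral>\<^sup>+ x\<in>{0..}. ennreal ((1 - F x) powr (1 / real CARD('d))) \<partial>lborel) < \<infinity>"
    and growth: "animal_growth_constant M X N"
    and critical: "N = 0"
    and c: "c > real CARD('d) / (real CARD('d) - 1)"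
  shows "AE \<omega> in M.
    (\<lambda>n. ln (real n) powr (- c) * (max_weight_box (\<lambda>v. X v \<omega>) n / real n)) \<longlonglongrightarrow> 0"
proof -
  interpret iid_field M X F
    using prob indep law by (simp add: iid_field_def iid_field_axioms_def)
  have "real CARD('d) / (real CARD('d) - 1) > 0" using dim by simp
  then have c0: "c > 0" using c by linarith
  let ?P = "\<lambda>i m x. heavy (1 / real (Suc i) * 2 ^ m * real m powr c) (lattice_box (2 ^ m)) x"
  have zero: "AE \<omega> in M. (\<lambda>n. max_weight_size (\<lambda>v. X v \<omega>) n / real n) \<longlonglongrightarrow> 0"
    using growth critical by (simp add: animal_growth_constant_def)
  have "AE \<omega> in M. \<forall>i. eventually (\<lambda>m. \<not> ?P i m (\<lambda>v. X v \<omega>)) sequentially"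
    unfolding AE_all_countable by (intro allI AE_eventually_not_heavy[OF dim c _ zero]) simp
  then show ?thesis
  proof eventually_elim
    case (elim \<omega>)
    let ?x = "\<lambda>v. X v \<omega>"
    let ?g = "\<lambda>n. ln (real n) powr (- c) * (max_weight_box ?x n / real n)"
    show ?case
    proof (rule order_tendstoI)
      fix a :: real assume a: "a < 0"
      have "(\<lambda>n. ln (real n) powr (- c) * (?x 0 / real n)) \<longlonglongrightarrow> 0" using c0 by real_asymp
      from order_tendstoD(1)[OF this a] eventually_ge_at_top[of 1]
      show "eventually (\<lambda>n. a < ?g n) sequentially"
      proof eventually_elim
        case (elim n)
        have "ln (real n) powr (- c) * (?x 0 / real n) \<le> ?g n"
          using max_weight_box_ge_origin[of n ?x] elim(2) by (intro mult_left_mono divide_right_mono) auto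
        then show ?case using elim(1) by linarith
      qed
    next
      fix a :: real assume a: "0 < a"
      obtain i where i: "inverse (real (Suc i)) < a / (2 * 4 powr c)"
        using reals_Archimedean[of "a / (2 * 4 powr c)"] a by auto
      have "eventually (\<lambda>n. ?g n \<le> 2 * (1 / real (Suc i)) * 4 powr c) sequentially"
        using elim by (intro max_weight_box_dyadic_bound c0) auto
      then show "eventually (\<lambda>n. ?g n < a) sequentially"
      proof eventually_elim
        case (elim n)
        have "2 * (1 / real (Suc i)) * 4 powr c < a"
          using i by (simp add: field_simps)
        then show ?case using elim by linarith
      qed
    qed
  qed
qed

end
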